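(* Let $X$ be a compact symmetric space with compact symmetry group $G$, let $r>0$ and $1<p_0<\infty$. Suppose $T$ is a linear operator which is translation invariant, maps $L\log^r L(X)$ boundedly to $L^1(X)$, and is bounded on $L^{p_0}(X)$. Then $T$ is bounded on $L^p(X)$ for every $1<p<p_0$, with operator norm $O((p-1)^{-r})$; that is, there is a constant $C$, independent of $p$ (depending only on $r$, $p_0$, the space $X$ with its group $G$, and the operator norms of $T$ from $L\log^r L$ to $L^1$ and on $L^{p_0}$), such that $$\|Tf\|_{L^p(X)} \le C\,(p-1)^{-r}\,\|f\|_{L^p(X)}\qquad\text{for all } f\in L^p(X),\ 1<p<p_0 .$$
   Context: $X$ is equipped with its finite $G$-invariant measure, denoted $|\cdot|$; $G$ acts transitively on $X$ by measure-preserving transformations. An operator $T$ is translation invariant if it commutes with the action of $G$: $T(f\circ\Omega)=(Tf)\circ\Omega$ for all $\Omega\in G$. $L\log^r L(X)$ is the Orlicz space of measurable functions $f$ on $X$ with $\int_X |f|\log^r(2+|f|)<\infty$, with norm $\|f\|_{L\log^r L}=\inf\{\lambda>0:\int_X \frac{|f|}{\lambda}\log^r(2+\frac{|f|}{\lambda})\le 1\}$. Since $X$ has finite measure, $L^p(X)\subset L\log^r L(X)$ for every $p>1$. *)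

theory Defs
  imports "HOL-Analysis.Analysis" "HOL-Algebra.Bij"
begin

section \<open>Riemannian manifolds\<close>

text \<open>A chart is a pair of its domain and its coordinate map; the coordinate map is irrelevant
  outside the domain. The model space \<open>'e\<close> is required to be finite-dimensional below; it is not
  taken from the class \<open>euclidean_space\<close> because that class excludes dimension zero.\<close>

type_synonym ('a, 'e) chart = "'a set \<times> ('a \<Rightarrow> 'e)"

abbreviation chart_inv :: "('a, 'e) chart \<Rightarrow> 'e \<Rightarrow> 'a" where
  "chart_inv c \<equiv> inv_into (fst c) (snd c)"

text \<open>Continuous differentiability of order \<open>k\<close>, by iterated directional derivatives. It is only
  meant for open \<open>S\<close>, the derivative at a point of \<open>S\<close> being a full one.\<close>

primrec Ck_on :: "nat \<Rightarrow> 'e::real_normed_vector set \<Rightarrow> ('e \<Rightarrow> 'f::real_normed_vector) \<Rightarrow> bool" where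
  "Ck_on 0 S f \<longleftrightarrow> continuous_on S f"
| "Ck_on (Suc k) S f \<longleftrightarrow> (\<forall>x\<in>S. f differentiable (at x)) \<and>
     (\<forall>v. Ck_on k S (\<lambda>x. frechet_derivative f (at x) v))"

definition smooth_on :: "'e::real_normed_vector set \<Rightarrow> ('e \<Rightarrow> 'f::real_normed_vector) \<Rightarrow> bool" where
  "smooth_on S f \<longleftrightarrow> (\<forall>k. Ck_on k S f)"

definition smooth_map ::
    "('a::topological_space, 'e::real_normed_vector) chart set \<Rightarrow> ('a \<Rightarrow> 'a) \<Rightarrow> bool" where
  "smooth_map \<A> F \<longleftrightarrow> continuous_on UNIV F \<and>
     (\<forall>c\<in>\<A>. \<forall>d\<in>\<A>. smooth_on (snd c ` (fst c \<inter> F -` fst d)) (snd d \<circ> F \<circ> chart_inv c))"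

definition chart_deriv ::
    "('a, 'e::real_normed_vector) chart \<Rightarrow> ('a, 'e) chart \<Rightarrow> ('a \<Rightarrow> 'a) \<Rightarrow> 'a \<Rightarrow> 'e \<Rightarrow> 'e" where
  "chart_deriv c d F x = frechet_derivative (snd d \<circ> F \<circ> chart_inv c) (at (snd c x))"

text \<open>A metric tensor is given by its coordinate expressions: \<open>g c x v w\<close> is the inner product of
  the tangent vectors at \<open>x\<close> whose coordinates in the chart \<open>c\<close> are \<open>v\<close> and \<open>w\<close>.\<close>

type_synonym ('a, 'e) metric_tensor = "('a, 'e) chart \<Rightarrow> 'a \<Rightarrow> 'e \<Rightarrow> 'e \<Rightarrow> real"

definition preserves_metric ::
    "('a, 'e::real_normed_vector) chart set \<Rightarrow> ('a, 'e) metric_tensor \<Rightarrow> ('a \<Rightarrow> 'a) \<Rightarrow> bool" where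
  "preserves_metric \<A> g F \<longleftrightarrow>
     (\<forall>c\<in>\<A>. \<forall>d\<in>\<A>. \<forall>x\<in>fst c \<inter> F -` fst d. \<forall>v w.
        g d (F x) (chart_deriv c d F x v) (chart_deriv c d F x w) = g c x v w)"

text \<open>For \<open>F = id\<close>, \<open>smooth_map\<close> says that all transition maps are smooth, and
  \<open>preserves_metric\<close> that the coordinate expressions of the metric in different charts agree.\<close>

definition riemannian_manifold ::
    "('a::{t2_space,second_countable_topology}, 'e::real_normed_vector) chart set
      \<Rightarrow> ('a, 'e) metric_tensor \<Rightarrow> bool" where
  "riemannian_manifold \<A> g \<longleftrightarrow>
     (\<exists>B::'e set. finite B \<and> span B = UNIV) \<and>
     (\<Union>c\<in>\<A>. fst c) = UNIV \<and>
     (\<forall>c\<in>\<A>. open (fst c) \<and> open (snd c ` fst c) \<and>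
        homeomorphism (fst c) (snd c ` fst c) (snd c) (chart_inv c)) \<and>
     smooth_map \<A> id \<and>
     (\<forall>c\<in>\<A>. \<forall>x\<in>fst c. bilinear (g c x) \<and> (\<forall>v w. g c x v w = g c x w v) \<and>
        (\<forall>v. v \<noteq> 0 \<longrightarrow> 0 < g c x v v)) \<and>
     (\<forall>c\<in>\<A>. \<forall>v w. smooth_on (snd c ` fst c) (\<lambda>y. g c (chart_inv c y) v w)) \<and>
     preserves_metric \<A> g id"

definition riemannian_isometry ::
    "('a::topological_space, 'e::real_normed_vector) chart set \<Rightarrow> ('a, 'e) metric_tensor
      \<Rightarrow> ('a \<Rightarrow> 'a) \<Rightarrow> bool" where
  "riemannian_isometry \<A> g F \<longleftrightarrow> bij F \<and> smooth_map \<A> F \<and> smooth_map \<A> (inv_into UNIV F) \<and>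
     preserves_metric \<A> g F"


section \<open>Compact symmetric spaces and their symmetry groups\<close>

text \<open>Helgason's definition: every point is an isolated fixed point of an involutive isometry.\<close>

definition compact_symmetric_space ::
    "('a::{t2_space,second_countable_topology}, 'e::real_normed_vector) chart set
      \<Rightarrow> ('a, 'e) metric_tensor \<Rightarrow> bool" where
  "compact_symmetric_space \<A> g \<longleftrightarrow>
     riemannian_manifold \<A> g \<and> compact (UNIV :: 'a set) \<and> connected (UNIV :: 'a set) \<and>
     (\<forall>x. \<exists>s. riemannian_isometry \<A> g s \<and> s \<circ> s = id \<and> s x = x \<and>
        (\<exists>N. open N \<and> x \<in> N \<and> (\<forall>y\<in>N. s y = y \<longrightarrow> y = x)))"

definition compact_open_topology ::
    "('a::topological_space \<Rightarrow> 'b::topological_space) topology" where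
  "compact_open_topology =
     topology_generated_by {{f. f ` K \<subseteq> U} | K U. compact K \<and> open U}"

text \<open>The group is not required to be the full isometry group: on the torus, for instance, it may
  consist of the translations only.\<close>

definition compact_symmetry_group ::
    "('a::topological_space, 'e::real_normed_vector) chart set \<Rightarrow> ('a, 'e) metric_tensor
      \<Rightarrow> ('a \<Rightarrow> 'a) set \<Rightarrow> bool" where
  "compact_symmetry_group \<A> g G \<longleftrightarrow>
     subgroup G (BijGroup UNIV) \<and> (\<forall>\<Omega>\<in>G. riemannian_isometry \<A> g \<Omega>) \<and>
     compactin compact_open_topology G \<and> (\<forall>x y. \<exists>\<Omega>\<in>G. \<Omega> x = y)"

text \<open>Such a measure is unique up to a positive factor; no normalization is imposed.\<close>

definition finite_invariant_measure ::
    "('a::topological_space \<Rightarrow> 'a) set \<Rightarrow> 'a measure \<Rightarrow> bool" where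
  "finite_invariant_measure G M \<longleftrightarrow> sets M = sets borel \<and> finite_measure M \<and>
     emeasure M UNIV > 0 \<and> (\<forall>\<Omega>\<in>G. distr M M \<Omega> = M)"


section \<open>Function spaces and operators\<close>

text \<open>Elements of the function spaces are functions, not classes modulo equality almost everywhere.
  Operators are functions on functions whose values matter only up to null sets and only on the
  space under consideration.\<close>

definition Lp_space :: "real \<Rightarrow> 'a measure \<Rightarrow> ('a \<Rightarrow> complex) set" where
  "Lp_space p M = {f \<in> borel_measurable M. integrable M (\<lambda>x. norm (f x) powr p)}"

definition Lp_norm :: "real \<Rightarrow> 'a measure \<Rightarrow> ('a \<Rightarrow> complex) \<Rightarrow> real" where
  "Lp_norm p M f = (\<integral>x. norm (f x) powr p \<partial>M) powr (1 / p)"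

definition LlogL_space :: "real \<Rightarrow> 'a measure \<Rightarrow> ('a \<Rightarrow> complex) set" where
  "LlogL_space r M = {f \<in> borel_measurable M.
     (\<integral>\<^sup>+x. ennreal (norm (f x) * ln (2 + norm (f x)) powr r) \<partial>M) < \<infinity>}"

definition LlogL_norm :: "real \<Rightarrow> 'a measure \<Rightarrow> ('a \<Rightarrow> complex) \<Rightarrow> real" where
  "LlogL_norm r M f = Inf {l. 0 < l \<and>
     (\<integral>\<^sup>+x. ennreal (norm (f x) / l * ln (2 + norm (f x) / l) powr r) \<partial>M) \<le> 1}"

definition linear_operator_on ::
    "('a \<Rightarrow> complex) set \<Rightarrow> 'a measure \<Rightarrow> (('a \<Rightarrow> complex) \<Rightarrow> ('a \<Rightarrow> complex)) \<Rightarrow> bool" where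
  "linear_operator_on V M T \<longleftrightarrow> (\<forall>f\<in>V. \<forall>h\<in>V. \<forall>a b.
     AE x in M. T (\<lambda>y. a * f y + b * h y) x = a * T f x + b * T h x)"

definition translation_invariant_on ::
    "('a \<Rightarrow> complex) set \<Rightarrow> 'a measure \<Rightarrow> ('a \<Rightarrow> 'a) set
      \<Rightarrow> (('a \<Rightarrow> complex) \<Rightarrow> ('a \<Rightarrow> complex)) \<Rightarrow> bool" where
  "translation_invariant_on V M G T \<longleftrightarrow> (\<forall>f\<in>V. \<forall>\<Omega>\<in>G.
     AE x in M. T (f \<circ> \<Omega>) x = (T f \<circ> \<Omega>) x)"

definition bounded_operator ::
    "'v set \<Rightarrow> ('v \<Rightarrow> real) \<Rightarrow> 'w set \<Rightarrow> ('w \<Rightarrow> real) \<Rightarrow> ('v \<Rightarrow> 'w) \<Rightarrow> bool" where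
  "bounded_operator V nV W nW T \<longleftrightarrow>
     (\<forall>f\<in>V. T f \<in> W) \<and> (\<exists>K. \<forall>f\<in>V. nW (T f) \<le> K * nV f)"

definition operator_norm ::
    "'v set \<Rightarrow> ('v \<Rightarrow> real) \<Rightarrow> ('w \<Rightarrow> real) \<Rightarrow> ('v \<Rightarrow> 'w) \<Rightarrow> real" where
  "operator_norm V nV nW T = Inf {K. 0 \<le> K \<and> (\<forall>f\<in>V. nW (T f) \<le> K * nV f)}"

end

theory Submission imports Defs begin

text \<open>
  Write $\mu$ for the total mass of $X$ and, for a function $h$, $h_s = |h| 1_{|h| \ge s}$. The
  exponent $r$, and not $r + 1/p$, in the blow-up rate comes from controlling the integral of
  $h_s$ and not merely the measure of its support.

  \<^emph>\<open>From $L\log^r L$ to $L^q$.\<close> For $q$ near $1$, $u \log^r(2+u)$ is bounded by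
  $O((q-1)^{-r}) (1 + u^q)$, so $T$ maps $L^q$ to $L^1$ with norm $\kappa = O((q-1)^{-r})$
  (\<open>Lp_space_subset_LlogL\<close>).

  \<^emph>\<open>Translation invariance improves this to a scale-invariant bound.\<close> Put $h = Tf$, let $\delta$
  be the measure of the set where $|h| \ge s$, and take about $\mu/\delta$ translates $f \circ \Omega_i$
  with random signs. Since $q \le 2$, the $q$-th power of the $L^q$ norm of the signed sum is at most
  the sum of the $q$-th powers, on average. Applying $T$ gives the signed sum of the translates of $h$,
  whose $L^1$ norm is on average at least that of their maximum (\<open>max_images_le\<close>). The translates can be
  chosen so that the copies of $h_s$ are spread over $X$ with little overlap, hence the maximum
  has $L^1$ norm comparable to $\mu/\delta$ times that of $h_s$ (\<open>spread_translates\<close>).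
  Together this is \<open>level_set_estimate\<close>:
  $\int h_s \le O(\kappa)^q s^{1-q} \int |f|^q$.

  \<^emph>\<open>Choosing the translates.\<close> They are found greedily: as long as at most half of $X$ is covered,
  some translate of $h_s$ has a quarter of its integral off the covered part. This follows from
  the fact that some average of translates of a continuous function is bounded below by almost its
  mean value, a consequence of the equicontinuity and transitivity of the compact group
  (\<open>translate_integral_ge_continuous\<close>), and from the density of the continuous functions in $L^1$
  (\<open>integrable_approximable\<close>).

  \<^emph>\<open>Interpolation.\<close> With $q = 1 + (p-1)/(2p_0)$, split $f = f_1 + f_2$ at height $l$ and compare the
  integrals of $\min(|Tf|/l, (|Tf|/l)^{p_0})$ against $l^{p-1}\,dl$. On the left this produces the
  constant $1/(p-1) + 1/(p_0-p)$. On the right, the level set estimate for $f_1$ and the $L^{p_0}$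
  bound for $f_2$ produce $1/(p-q)$ and $1/(p_0-p)$, so the divergent constants cancel both as
  $p \to 1$ and as $p \to p_0$ (\<open>interpolation\<close>). What remains is
  $O(\kappa)^q = O((p-1)^{-rq})$, whose $p$-th root is $O((p-1)^{-r})$ because $q \le p$.
\<close>

text \<open>For the nonnegative functions to which this is applied, the value \<open>0\<close> at the empty list makes this the
maximum over the list.\<close>

fun max_list :: "('b \<Rightarrow> real) \<Rightarrow> 'b list \<Rightarrow> real" where
  "max_list f [] = 0"
| "max_list f (x # xs) = max (f x) (max_list f xs)"

lemma max_list_map: "max_list F (map h xs) = max_list (\<lambda>x. F (h x)) xs"
  by (induction xs) auto

lemma max_list_mono: "(\<And>x. x \<in> set xs \<Longrightarrow> F x \<le> H x) \<Longrightarrow> max_list F xs \<le> max_list H xs"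
proof (induction xs)
  case (Cons a xs)
  then show ?case unfolding max_list.simps by (intro max.mono) auto
qed simp

section \<open>Averages over translates\<close>

locale compact_homogeneous_space = finite_measure M
  for M :: "'a::{t2_space,second_countable_topology} measure" +
  fixes G :: "('a \<Rightarrow> 'a) set"
  assumes compact_UNIV: "compact (UNIV :: 'a set)"
    and sets_M: "sets M = sets borel"
    and measure_pos: "measure M UNIV > 0"
    and id_in_G: "id \<in> G"
    and comp_in_G: "\<Omega> \<in> G \<Longrightarrow> \<Theta> \<in> G \<Longrightarrow> \<Omega> \<circ> \<Theta> \<in> G"
    and continuous_G: "\<Omega> \<in> G \<Longrightarrow> continuous_on UNIV \<Omega>"
    and compact_G: "compactin compact_open_topology G"
    and transitive: "\<exists>\<Omega>\<in>G. \<Omega> x = y"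
    and invariant: "\<Omega> \<in> G \<Longrightarrow> distr M M \<Omega> = M"
begin

lemma space_M: "space M = UNIV"
  using sets_eq_imp_space_eq[OF sets_M] by simp

lemma measurable_G: "\<Omega> \<in> G \<Longrightarrow> \<Omega> \<in> measurable M M"
  using borel_measurable_continuous_onI[OF continuous_G] measurable_cong_sets[OF sets_M sets_M]
  by blast

lemma continuous_measurable:
  fixes v :: "'a \<Rightarrow> real"
  shows "continuous_on UNIV v \<Longrightarrow> v \<in> borel_measurable M"
  using borel_measurable_continuous_onI measurable_cong_sets[OF sets_M refl] by blast

lemma continuous_bounded:
  fixes v :: "'a \<Rightarrow> real"
  assumes "continuous_on UNIV v"
  obtains B where "0 \<le> B" "\<And>x. \<bar>v x\<bar> \<le> B"
proof -
  have "bounded (range v)"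
    using compact_continuous_image[OF assms compact_UNIV] compact_imp_bounded by blast
  then obtain B where "\<And>x. \<bar>v x\<bar> \<le> B" unfolding bounded_iff by auto
  moreover from this have "0 \<le> B" using abs_ge_zero order_trans by blast
  ultimately show thesis using that by blast
qed

lemma continuous_integrable:
  fixes w :: "'a \<Rightarrow> real"
  assumes "continuous_on UNIV w"
  shows "integrable M w"
proof -
  from continuous_bounded[OF assms] obtain B where "\<And>x. \<bar>w x\<bar> \<le> B" by blast
  then show ?thesis
    by (intro integrable_const_bound[of _ B] continuous_measurable assms) auto
qed

lemma integral_translate:
  fixes v :: "'a \<Rightarrow> 'b::{banach, second_countable_topology}"
  assumes "\<Omega> \<in> G" and "v \<in> borel_measurable M"
  shows "(\<integral>x. v (\<Omega> x) \<partial>M) = (\<integral>x. v x \<partial>M)"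
  using integral_distr[OF measurable_G[OF assms(1)] assms(2)] invariant[OF assms(1)] by simp

lemma integrable_translate:
  fixes v :: "'a \<Rightarrow> 'b::{banach, second_countable_topology}"
  assumes "\<Omega> \<in> G" and "integrable M v"
  shows "integrable M (\<lambda>x. v (\<Omega> x))"
  by (rule integrable_distr[OF measurable_G[OF assms(1)]]) (simp add: invariant assms)

lemma measure_translate:
  assumes "\<Omega> \<in> G" and "E \<in> sets M"
  shows "\<Omega> -` E \<in> sets M" "measure M (\<Omega> -` E) = measure M E"
proof -
  show "\<Omega> -` E \<in> sets M"
    using measurable_sets[OF measurable_G[OF assms(1)] assms(2)] by (simp add: space_M)
  show "measure M (\<Omega> -` E) = measure M E"
    using measure_distr[OF measurable_G[OF assms(1)] assms(2)] invariant[OF assms(1)]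
    by (simp add: space_M)
qed

text \<open>Compactness of the group gives equicontinuity. Around a fixed \<open>\<Theta>\<close> in the group,
\<open>v \<circ> \<Theta>\<close> hardly varies on some compact neighbourhood \<open>K\<close> of \<open>x\<close>, and the maps
sending \<open>K\<close> into the set where \<open>v\<close> is close to \<open>v (\<Theta> x)\<close> form a compact-open neighbourhood of
\<open>\<Theta>\<close>. Finitely many of these neighbourhoods cover the group.\<close>

lemma equicontinuous_at:
  fixes v :: "'a \<Rightarrow> real"
  assumes v: "continuous_on UNIV v" and e: "0 < e"
  shows "\<exists>W. open W \<and> x \<in> W \<and> (\<forall>\<Omega>\<in>G. \<forall>y\<in>W. \<bar>v (\<Omega> y) - v (\<Omega> x)\<bar> < e)"
proof -
  define K where "K \<Theta> = {y. \<bar>v (\<Theta> y) - v (\<Theta> x)\<bar> \<le> e/4}" for \<Theta>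
  define W where "W \<Theta> = {y. \<bar>v (\<Theta> y) - v (\<Theta> x)\<bar> < e/4}" for \<Theta>
  define U where "U \<Theta> = {z. \<bar>v z - v (\<Theta> x)\<bar> < e/2}" for \<Theta>
  define N where "N \<Theta> = {f. f ` K \<Theta> \<subseteq> U \<Theta>}" for \<Theta> :: "'a \<Rightarrow> 'a"
  have cv: "continuous_on UNIV (\<lambda>y. v (\<Theta> y))" if "\<Theta> \<in> G" for \<Theta>
    using continuous_on_compose2[OF v continuous_G[OF that]] by simp
  have K: "compact (K \<Theta>)" if "\<Theta> \<in> G" for \<Theta>
  proof -
    have "closed (K \<Theta>)" unfolding K_def
      by (intro closed_Collect_le continuous_intros cv that)
    then show ?thesis using compact_Int_closed[OF compact_UNIV] by simp
  qed
  have W: "open (W \<Theta>)" if "\<Theta> \<in> G" for \<Theta>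
    unfolding W_def by (intro open_Collect_less continuous_intros cv that)
  have U: "open (U \<Theta>)" for \<Theta>
    unfolding U_def by (intro open_Collect_less continuous_intros v)
  have "\<forall>V\<in>N ` G. openin compact_open_topology V"
    unfolding compact_open_topology_def N_def using K U
    by (auto intro!: topology_generated_by_Basis)
  moreover have "G \<subseteq> \<Union>(N ` G)"
  proof
    fix \<Theta> assume "\<Theta> \<in> G"
    moreover have "\<Theta> \<in> N \<Theta>" unfolding N_def K_def U_def using e by auto
    ultimately show "\<Theta> \<in> \<Union>(N ` G)" by blast
  qed
  ultimately obtain \<F> where "finite \<F>" "\<F> \<subseteq> N ` G" "G \<subseteq> \<Union>\<F>"
    using compact_G unfolding compactin_def by (metis (no_types, lifting))
  obtain H where H: "H \<subseteq> G" "finite H" "\<F> = N ` H"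
    using finite_subset_image[OF \<open>finite \<F>\<close> \<open>\<F> \<subseteq> N ` G\<close>] by blast
  with \<open>G \<subseteq> \<Union>\<F>\<close> have cover: "G \<subseteq> \<Union>(N ` H)" by simp
  let ?W = "\<Inter>\<Theta>\<in>H. W \<Theta>"
  have "open ?W" using H W by (intro open_INT) auto
  moreover have "x \<in> ?W" unfolding W_def using e by auto
  moreover have "\<bar>v (\<Omega> y) - v (\<Omega> x)\<bar> < e" if \<Omega>: "\<Omega> \<in> G" and y: "y \<in> ?W" for \<Omega> y
  proof -
    obtain \<Theta> where "\<Theta> \<in> H" "\<Omega> \<in> N \<Theta>" using cover \<Omega> by blast
    moreover have "x \<in> K \<Theta>" "y \<in> K \<Theta>"
      using e y \<open>\<Theta> \<in> H\<close> unfolding K_def W_def by force+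
    ultimately have "\<Omega> x \<in> U \<Theta>" "\<Omega> y \<in> U \<Theta>" unfolding N_def by blast+
    then show ?thesis unfolding U_def by (simp add: abs_if split: if_splits)
  qed
  ultimately show ?thesis by blast
qed

lemma finite_translates_cover:
  assumes "open W" "W \<noteq> {}"
  shows "\<exists>H. finite H \<and> H \<subseteq> G \<and> (\<forall>y. \<exists>\<Omega>\<in>H. \<Omega> y \<in> W)"
proof -
  obtain w where w: "w \<in> W" using assms by blast
  have "UNIV \<subseteq> (\<Union>\<Omega>\<in>G. \<Omega> -` W)"
    using transitive w by fast
  moreover have "open (\<Omega> -` W)" if "\<Omega> \<in> G" for \<Omega>
    using continuous_G[OF that] assms(1) open_vimage by blast
  ultimately obtain H where "H \<subseteq> G" "finite H" "UNIV \<subseteq> (\<Union>\<Omega>\<in>H. \<Omega> -` W)"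
    using compactE_image[OF compact_UNIV] by metis
  then show ?thesis by (intro exI[of _ H]) blast
qed

text \<open>The finite set \<open>H\<close> depends on \<open>v\<close> and \<open>e\<close> only, and it moves every point into every
member of the cover. Since averages of translates of \<open>v\<close> oscillate on the cover no more than \<open>v\<close>
does, the same \<open>H\<close> can be used over and over when averaging is iterated.\<close>

lemma uniform_translates:
  fixes v :: "'a \<Rightarrow> real"
  assumes v: "continuous_on UNIV v" and e: "0 < e"
  shows "\<exists>\<W> H. \<Union>\<W> = UNIV \<and> finite H \<and> H \<noteq> {} \<and> H \<subseteq> G \<and>
    (\<forall>W\<in>\<W>. \<forall>y. \<exists>\<Omega>\<in>H. \<Omega> y \<in> W) \<and>
    (\<forall>W\<in>\<W>. \<forall>y\<in>W. \<forall>z\<in>W. \<forall>\<Omega>\<in>G. \<bar>v (\<Omega> y) - v (\<Omega> z)\<bar> \<le> e)"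
proof -
  obtain W where W: "\<And>x. open (W x)" "\<And>x. x \<in> W x"
    "\<And>x \<Omega> y. \<Omega> \<in> G \<Longrightarrow> y \<in> W x \<Longrightarrow> \<bar>v (\<Omega> y) - v (\<Omega> x)\<bar> < e/2"
    using equicontinuous_at[OF v, of "e/2"] e by (metis half_gt_zero)
  obtain I where I: "finite I" "(\<Union>x\<in>I. W x) = UNIV"

  proof -
    have "UNIV \<subseteq> (\<Union>x\<in>UNIV. W x)" using W(2) by blast
    from compactE_image[OF compact_UNIV _ this] W(1) show thesis
      using that by (metis top.extremum_uniqueI)
  qed
  obtain H where H: "\<And>x. finite (H x) \<and> H x \<subseteq> G \<and> (\<forall>y. \<exists>\<Omega>\<in>H x. \<Omega> y \<in> W x)"

  proof -
    have "\<forall>x. \<exists>K. finite K \<and> K \<subseteq> G \<and> (\<forall>y. \<exists>\<Omega>\<in>K. \<Omega> y \<in> W x)"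
      using finite_translates_cover[OF W(1)] W(2) by blast
    then show thesis using that by (metis (no_types, lifting) choice)
  qed
  have "I \<noteq> {}" using I by blast
  have "H x \<noteq> {}" for x using H by blast
  have osc: "\<bar>v (\<Omega> y) - v (\<Omega> z)\<bar> \<le> e" if "y \<in> W x" "z \<in> W x" "\<Omega> \<in> G" for x y z \<Omega>
    using W(3)[OF that(3,1)] W(3)[OF that(3,2)] by linarith
  show ?thesis
  proof (intro exI[of _ "W ` I"] exI[of _ "\<Union>x\<in>I. H x"] conjI)
    show "(\<Union>x\<in>I. H x) \<noteq> {}" using \<open>I \<noteq> {}\<close> \<open>\<And>x. H x \<noteq> {}\<close> by blast
    show "\<forall>U\<in>W ` I. \<forall>y. \<exists>\<Omega>\<in>\<Union>x\<in>I. H x. \<Omega> y \<in> U" using H by blast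
  qed (use I H osc in auto)
qed

text \<open>Were the conclusion false for all \<open>\<Omega>\<close>, it would stay false for every average of translates of
\<open>v\<close>. But such averages can be bounded below by almost the mean \<open>c\<close> of \<open>v\<close>: an
average \<open>w\<close> is at least \<open>c - e/2\<close> on some member of the cover, and averaging \<open>w\<close> over \<open>H\<close>
spreads this member over the whole space, so that the distance of the lower bound from \<open>c - e/2\<close>
shrinks by the factor \<open>1 - 1/n\<close>, where \<open>n\<close> is the size of \<open>H\<close>.\<close>

lemma translate_integral_ge_continuous:
  fixes v :: "'a \<Rightarrow> real"
  assumes v: "continuous_on UNIV v" and A: "A \<in> sets M" and e: "0 < e"
  shows "\<exists>\<Omega>\<in>G. ((\<integral>x. v x \<partial>M) / measure M UNIV - e) * measure M A
    \<le> (\<integral>x. indicator A x * v (\<Omega> x) \<partial>M)"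
proof (cases "measure M A = 0")
  case True
  then have "A \<in> null_sets M"
    using A by (simp add: emeasure_eq_measure null_setsI)
  from AE_not_in[OF this] have "AE x in M. indicator A x * v x = 0"
    by eventually_elim auto
  then have "(\<integral>x. indicator A x * v x \<partial>M) = 0"
    by (intro integral_eq_zero_AE)
  then show ?thesis using True id_in_G by (intro bexI[of _ id]) auto
next
  case False
  define \<mu> where "\<mu> = measure M UNIV"
  define c where "c = (\<integral>x. v x \<partial>M) / \<mu>"
  have \<mu>: "\<mu> > 0" unfolding \<mu>_def by (rule measure_pos)
  show ?thesis
  proof (rule ccontr)
    assume "\<not> ?thesis"
    then have small: "\<And>\<Omega>. \<Omega> \<in> G \<Longrightarrow> (\<integral>x. indicator A x * v (\<Omega> x) \<partial>M) \<le> (c - e) * measure M A"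
      unfolding c_def \<mu>_def by force
    obtain \<W> H where \<W>: "\<Union>\<W> = UNIV" and H: "finite H" "H \<noteq> {}" "H \<subseteq> G"
      and hit: "\<And>W y. W \<in> \<W> \<Longrightarrow> \<exists>\<Omega>\<in>H. \<Omega> y \<in> W"
      and osc: "\<And>W y z \<Omega>. W \<in> \<W> \<Longrightarrow> y \<in> W \<Longrightarrow> z \<in> W \<Longrightarrow> \<Omega> \<in> G \<Longrightarrow> \<bar>v (\<Omega> y) - v (\<Omega> z)\<bar> \<le> e/4"
      using uniform_translates[OF v, of "e/4"] e by (metis (no_types, lifting) divide_pos_pos zero_less_numeral)
    define n where "n = real (card H)"
    have n: "n \<ge> 1" using H unfolding n_def by (simp add: Suc_le_eq card_gt_0_iff)
    \<comment> \<open>The class \<open>S\<close> records what is inherited by averages of translates of \<open>v\<close>; it spares an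
      explicit description of these averages.\<close>
    define S where "S = {w. continuous_on UNIV w \<and> (\<integral>x. w x \<partial>M) = c * \<mu> \<and>
      (\<forall>W\<in>\<W>. \<forall>y\<in>W. \<forall>z\<in>W. \<forall>\<Omega>\<in>G. \<bar>w (\<Omega> y) - w (\<Omega> z)\<bar> \<le> e/4) \<and>
      (\<forall>\<Omega>\<in>G. (\<integral>x. indicator A x * w (\<Omega> x) \<partial>M) \<le> (c - e) * measure M A)}"
    have S_osc: "\<bar>w (\<Omega> y) - w (\<Omega> z)\<bar> \<le> e/4"
      if "w \<in> S" "W \<in> \<W>" "y \<in> W" "z \<in> W" "\<Omega> \<in> G" for w W y z \<Omega>
      using that unfolding S_def by blast
    have S_A: "(\<integral>x. indicator A x * w (\<Omega> x) \<partial>M) \<le> (c - e) * measure M A"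
      if "w \<in> S" "\<Omega> \<in> G" for w \<Omega>
      using that unfolding S_def by blast
    have cont_tr: "continuous_on UNIV (\<lambda>x. w (\<Omega> x))"
      if "continuous_on UNIV w" "\<Omega> \<in> G" for w :: "'a \<Rightarrow> real" and \<Omega>
      using continuous_on_compose2[OF that(1) continuous_G[OF that(2)]] by simp
    note int = continuous_integrable
    have intA: "integrable M (\<lambda>x. indicator A x * w x)" if "continuous_on UNIV w" for w :: "'a \<Rightarrow> real"
      using integrable_mult_indicator[OF A int[OF that]] by simp
    have vS: "v \<in> S" unfolding S_def using v osc small \<mu> by (auto simp: c_def)
    define avg where "avg w x = (\<Sum>\<Omega>\<in>H. w (\<Omega> x)) / n" for w :: "'a \<Rightarrow> real" and x
    have avgS: "avg w \<in> S" if "w \<in> S" for w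
    proof -
      have w: "continuous_on UNIV w" using that unfolding S_def by blast
      have wt: "continuous_on UNIV (\<lambda>x. w (\<Omega> x))" if "\<Omega> \<in> H" for \<Omega>
        by (rule cont_tr[OF w]) (use that H in blast)
      have "continuous_on UNIV (\<lambda>x. (\<Sum>\<Omega>\<in>H. w (\<Omega> x)) / n)"
        using n by (intro continuous_on_divide continuous_on_sum continuous_on_const wt) auto
      then have "continuous_on UNIV (avg w)" unfolding avg_def .
      moreover have "(\<integral>x. avg w x \<partial>M) = c * \<mu>"
      proof -
        have "(\<integral>x. avg w x \<partial>M) = (\<Sum>\<Omega>\<in>H. \<integral>x. w (\<Omega> x) \<partial>M) / n"
          unfolding avg_def by (simp add: Bochner_Integration.integral_sum int wt)
        also have "(\<Sum>\<Omega>\<in>H. \<integral>x. w (\<Omega> x) \<partial>M) = (\<Sum>\<Omega>\<in>H. c * \<mu>)"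
        proof (rule sum.cong[OF refl])
          fix \<Omega> assume "\<Omega> \<in> H"
          then have "(\<integral>x. w (\<Omega> x) \<partial>M) = (\<integral>x. w x \<partial>M)"
            using integral_translate[OF _ continuous_measurable[OF w]] H by blast
          then show "(\<integral>x. w (\<Omega> x) \<partial>M) = c * \<mu>" using that unfolding S_def by simp
        qed
        finally show ?thesis using n by (simp add: n_def)
      qed
      moreover have "\<bar>avg w (\<Omega> y) - avg w (\<Omega> z)\<bar> \<le> e/4"
        if W: "W \<in> \<W>" "y \<in> W" "z \<in> W" "\<Omega> \<in> G" for W y z \<Omega>
      proof -
        have "\<bar>w (\<Theta> (\<Omega> y)) - w (\<Theta> (\<Omega> z))\<bar> \<le> e/4" if "\<Theta> \<in> H" for \<Theta>
        proof -
          have "\<Theta> \<circ> \<Omega> \<in> G" using comp_in_G that W H by blast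
          then have "\<bar>w ((\<Theta> \<circ> \<Omega>) y) - w ((\<Theta> \<circ> \<Omega>) z)\<bar> \<le> e/4"
            by (rule S_osc[OF \<open>w \<in> S\<close> W(1-3)])
          then show ?thesis by simp
        qed
        then have "(\<Sum>\<Theta>\<in>H. \<bar>w (\<Theta> (\<Omega> y)) - w (\<Theta> (\<Omega> z))\<bar>) \<le> n * (e/4)"
          unfolding n_def by (intro sum_bounded_above) auto
        then have "\<bar>\<Sum>\<Theta>\<in>H. w (\<Theta> (\<Omega> y)) - w (\<Theta> (\<Omega> z))\<bar> \<le> n * (e/4)"
          by (rule order_trans[OF sum_abs])
        moreover have "avg w (\<Omega> y) - avg w (\<Omega> z) = (\<Sum>\<Theta>\<in>H. w (\<Theta> (\<Omega> y)) - w (\<Theta> (\<Omega> z))) / n"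
          unfolding avg_def by (simp add: sum_subtractf diff_divide_distrib)
        ultimately have "\<bar>avg w (\<Omega> y) - avg w (\<Omega> z)\<bar> * n \<le> n * (e/4)"
          using n by (simp add: abs_divide)
        then show ?thesis using n by simp
      qed
      moreover have "(\<integral>x. indicator A x * avg w (\<Omega> x) \<partial>M) \<le> (c - e) * measure M A"
        if \<Omega>: "\<Omega> \<in> G" for \<Omega>
      proof -
        have co: "continuous_on UNIV (\<lambda>x. w (\<Theta> (\<Omega> x)))" if "\<Theta> \<in> H" for \<Theta>
          using cont_tr[OF cont_tr[OF w] \<Omega>] that H by blast
        have "(\<integral>x. indicator A x * avg w (\<Omega> x) \<partial>M)
          = (\<integral>x. (\<Sum>\<Theta>\<in>H. indicator A x * w (\<Theta> (\<Omega> x))) / n \<partial>M)"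
          unfolding avg_def by (simp add: sum_distrib_left)
        also have "\<dots> = (\<Sum>\<Theta>\<in>H. \<integral>x. indicator A x * w (\<Theta> (\<Omega> x)) \<partial>M) / n"
          by (simp add: Bochner_Integration.integral_sum intA co)
        also have "(\<Sum>\<Theta>\<in>H. \<integral>x. indicator A x * w (\<Theta> (\<Omega> x)) \<partial>M) \<le> n * ((c - e) * measure M A)"
          unfolding n_def
        proof (intro sum_bounded_above)
          fix \<Theta> assume "\<Theta> \<in> H"
          then have "\<Theta> \<circ> \<Omega> \<in> G" using comp_in_G \<Omega> H by blast
          then have "(\<integral>x. indicator A x * w ((\<Theta> \<circ> \<Omega>) x) \<partial>M) \<le> (c - e) * measure M A"
            by (rule S_A[OF \<open>w \<in> S\<close>])
          then show "(\<integral>x. indicator A x * w (\<Theta> (\<Omega> x)) \<partial>M) \<le> (c - e) * measure M A"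
            by simp
        qed
        finally show ?thesis using n by (simp add: divide_right_mono)
      qed
      ultimately show ?thesis unfolding S_def by blast
    qed
    from continuous_bounded[OF v] obtain B where B: "\<And>x. \<bar>v x\<bar> \<le> B" by blast
    define d where "d = \<bar>c\<bar> + B + 1"
    have d: "0 < d" using B[of undefined] unfolding d_def by linarith
    \<comment> \<open>\<open>d\<close> makes the bound trivial for \<open>v\<close> itself, at \<open>k = 0\<close>\<close>
    have iter: "\<exists>w\<in>S. \<forall>x. c - e/2 - (1 - 1/n)^k * d \<le> w x" for k
    proof (induction k)
      case 0
      have "c - e/2 - d \<le> v x" for x using B[of x] e unfolding d_def by linarith
      then show ?case using vS by auto
    next
      case (Suc k)
      define D where "D = (1 - 1/n)^k * d"
      have D: "0 \<le> D" unfolding D_def using n d by (simp add: divide_le_eq)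
      obtain w where w: "w \<in> S" "\<And>x. c - e/2 - D \<le> w x" using Suc unfolding D_def by blast
      have wc: "continuous_on UNIV w" and wi: "(\<integral>x. w x \<partial>M) = c * \<mu>"
        using w unfolding S_def by auto
      \<comment> \<open>otherwise the mean of \<open>w\<close> would be below \<open>c\<close>\<close>
      have "\<exists>y. c - e/8 \<le> w y"
      proof (rule ccontr)
        assume "\<not> ?thesis"
        then have "(\<integral>x. w x \<partial>M) \<le> (\<integral>x. c - e/8 \<partial>M)"
          by (intro integral_mono int wc) (auto simp: not_le less_imp_le)
        also have "\<dots> = (c - e/8) * \<mu>" by (simp add: \<mu>_def space_M)
        finally show False using wi mult_pos_pos[OF e \<mu>] by (simp add: left_diff_distrib)
      qed
      then obtain y where y: "c - e/8 \<le> w y" by blast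
      have "y \<in> \<Union>\<W>" using \<W> by simp
      then obtain W where W: "W \<in> \<W>" "y \<in> W" by (rule UnionE)
      have "c - e/2 \<le> w z" if "z \<in> W" for z
      proof -
        have "\<bar>w (id y) - w (id z)\<bar> \<le> e/4"
          by (rule S_osc[OF w(1) W that id_in_G])
        then show ?thesis unfolding id_apply using y e by arith
      qed
      have "c - e/2 - (1 - 1/n)^Suc k * d \<le> avg w x" for x
      proof -
        obtain \<Theta> where \<Theta>: "\<Theta> \<in> H" "\<Theta> x \<in> W" using hit[OF W(1)] by blast
        have "(\<Sum>\<Omega>\<in>H. (c - e/2 - D) + (if \<Omega> = \<Theta> then D else 0)) \<le> (\<Sum>\<Omega>\<in>H. w (\<Omega> x))"
          using w(2) \<open>\<And>z. z \<in> W \<Longrightarrow> c - e/2 \<le> w z\<close>[OF \<Theta>(2)] by (intro sum_mono) auto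
        also have "(\<Sum>\<Omega>\<in>H. (c - e/2 - D) + (if \<Omega> = \<Theta> then D else 0)) = n * (c - e/2 - D) + D"
          using H \<Theta> by (simp add: sum.distrib n_def)
        finally have "(n * (c - e/2 - D) + D) / n \<le> avg w x"
          unfolding avg_def using n by (intro divide_right_mono) auto
        moreover have "(n * (c - e/2 - D) + D) / n = c - e/2 - (1 - 1/n)^Suc k * d"
          using n by (simp add: D_def field_simps)
        ultimately show ?thesis by simp
      qed
      then show ?case using avgS[OF w(1)] by blast
    qed
    obtain k where k: "(1 - 1/n)^k < e/4 / d"
      using real_arch_pow_inv[of "e/4/d" "1 - 1/n"] e d n by auto
    obtain w where w: "w \<in> S" "\<And>x. c - e/2 - (1 - 1/n)^k * d \<le> w x" using iter by blast
    have wc: "continuous_on UNIV w" using w unfolding S_def by auto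
    have "c - 3*e/4 \<le> w x" for x
      using w(2)[of x] k d by (simp add: field_simps)
    then have "(\<integral>x. indicator A x * (c - 3*e/4) \<partial>M) \<le> (\<integral>x. indicator A x * w x \<partial>M)"
      by (intro integral_mono intA wc) (auto simp: indicator_def)
    also have "\<dots> \<le> (c - e) * measure M A"
      using S_A[OF w(1) id_in_G] by simp
    finally have "measure M A * (c - 3*e/4) \<le> (c - e) * measure M A"
      using A by (simp add: space_M)
    moreover have "0 < e * measure M A"
      using False e by (simp add: zero_less_measure_iff)
    ultimately show False by (simp add: algebra_simps)
  qed
qed

section \<open>Density of the continuous functions\<close>

lemma open_sets_M: "open U \<Longrightarrow> U \<in> sets M"
  by (simp add: sets_M)

text \<open>In a second countable regular space an open set is an increasing union of closed sets \<open>K n\<close>, and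
Urysohn functions that are 1 on \<open>K n\<close> and 0 off the open set converge to its indicator.\<close>

lemma indicator_open_approx:
  fixes e :: real
  assumes U: "open U" and e: "0 < e"
  shows "\<exists>f. continuous_on UNIV f \<and> (\<integral>x. \<bar>indicator U x - f x\<bar> \<partial>M) < e"
proof -
  have "Hausdorff_space (euclidean :: 'a topology)"
    unfolding Hausdorff_space_def using hausdorff by (auto simp: disjnt_def)
  moreover have "compact_space (euclidean :: 'a topology)"
    using compact_UNIV by (auto simp: compact_space_def)
  ultimately have normal: "normal_space (euclidean :: 'a topology)"
    and regular: "regular_space (euclidean :: 'a topology)"
    using compact_Hausdorff_or_regular_imp_normal_space compact_Hausdorff_imp_regular_space by blast+
  obtain \<B> :: "'a set set" where \<B>: "countable \<B>" "topological_basis \<B>"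
    using ex_countable_basis by blast
  define \<C> where "\<C> = insert {} {closure B |B. B \<in> \<B> \<and> closure B \<subseteq> U}"
  have "\<C> \<subseteq> insert {} (closure ` \<B>)" unfolding \<C>_def by blast
  moreover have "countable (insert {} (closure ` \<B>))" using \<B>(1) by simp
  ultimately have "countable \<C>" by (rule countable_subset)
  moreover have "\<C> \<noteq> {}" unfolding \<C>_def by (rule insert_not_empty)
  ultimately obtain C :: "nat \<Rightarrow> 'a set" where C: "range C = \<C>"
    using range_from_nat_into by metis
  have Un: "\<exists>i. x \<in> C i" if x: "x \<in> U" for x
  proof -
    obtain V W where "open V" "open W" "x \<in> V" "- U \<subseteq> W" "V \<inter> W = {}"
      using regular[unfolded regular_space_def, rule_format, of "- U" x] U x
      by (auto simp: disjnt_def)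
    then obtain B where B: "B \<in> \<B>" "x \<in> B" "B \<subseteq> V"
      using topological_basisE[OF \<B>(2)] by metis
    have "closure B \<subseteq> - W"
      using B(3) \<open>V \<inter> W = {}\<close> \<open>open W\<close> by (intro closure_minimal) auto
    then have "closure B \<in> \<C>" unfolding \<C>_def using B \<open>- U \<subseteq> W\<close> by blast
    then show ?thesis using C B(2) closure_subset by (metis rangeE subsetD)
  qed
  define K where "K n = (\<Union>i<n. C i)" for n :: nat
  have C_closed: "closed (C i) \<and> C i \<subseteq> U" for i
  proof -
    have "C i \<in> \<C>" using C by blast
    then show ?thesis unfolding \<C>_def by auto
  qed
  have K: "closed (K n)" "K n \<subseteq> U" for n
    using C_closed unfolding K_def by (auto intro!: closed_UN)
  have "\<exists>f. continuous_on UNIV f \<and> (\<forall>x. 0 \<le> f x \<and> f x \<le> (1::real)) \<and>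
      (\<forall>x\<in>-U. f x = 0) \<and> (\<forall>x\<in>K n. f x = 1)" for n
  proof -
    obtain f where "continuous_map euclidean (top_of_set {0..1::real}) f" "f ` (-U) \<subseteq> {0}" "f ` K n \<subseteq> {1}"
      using Urysohn_lemma[OF normal, of "- U" "K n" 0 1] U K[of n] by (auto simp: disjnt_def)
    then show ?thesis
      by (intro exI[of _ f]) (auto simp: continuous_map_in_subtopology image_subset_iff)
  qed
  then obtain f :: "nat \<Rightarrow> 'a \<Rightarrow> real" where f: "\<And>n. continuous_on UNIV (f n)"
    "\<And>n x. 0 \<le> f n x \<and> f n x \<le> 1" "\<And>n x. x \<notin> U \<Longrightarrow> f n x = 0" "\<And>n x. x \<in> K n \<Longrightarrow> f n x = 1"
    by (metis ComplI)
  have lim: "(\<lambda>n. \<bar>indicator U x - f n x\<bar>) \<longlonglongrightarrow> (0::real)" for x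
  proof (cases "x \<in> U")
    case True
    then obtain i where i: "x \<in> C i" using Un by blast
    have "\<bar>indicator U x - f n x\<bar> = 0" if "n \<ge> Suc i" for n
    proof -
      have "x \<in> K n" using that i unfolding K_def by force
      then show ?thesis using True f(4) by simp
    qed
    then show ?thesis using tendsto_eventually[of _ 0] eventually_sequentially by blast
  qed (simp add: f(3))
  have "(\<lambda>n. \<integral>x. \<bar>indicator U x - f n x\<bar> \<partial>M) \<longlonglongrightarrow> (\<integral>x. (0::real) \<partial>M)"
  proof (rule integral_dominated_convergence[where w = "\<lambda>_. 1"])
    show "(\<lambda>x. \<bar>indicator U x - f n x\<bar>) \<in> borel_measurable M" for n
      using open_sets_M[OF U] continuous_measurable[OF f(1)]
      by (intro borel_measurable_abs borel_measurable_diff borel_measurable_indicator)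
    show "AE x in M. norm \<bar>indicator U x - f n x\<bar> \<le> 1" for n
      using f(2) by (auto simp: indicator_def)
    show "AE x in M. (\<lambda>n. \<bar>indicator U x - f n x\<bar>) \<longlonglongrightarrow> (0::real)"
      using lim by simp
  qed auto
  then have "\<forall>\<^sub>F n in sequentially. (\<integral>x. \<bar>indicator U x - f n x\<bar> \<partial>M) < e"
    using e order_tendstoD(2) by fastforce
  then show ?thesis using f(1) by (meson eventually_happens trivial_limit_sequentially)
qed

definition L1_approximable :: "('a \<Rightarrow> real) \<Rightarrow> bool" where
  "L1_approximable v \<longleftrightarrow> integrable M v \<and>
     (\<forall>e>0. \<exists>f. continuous_on UNIV f \<and> (\<integral>x. \<bar>v x - f x\<bar> \<partial>M) < e)"

lemma L1_approximable_lincomb: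
  assumes "L1_approximable v" "L1_approximable w"
  shows "L1_approximable (\<lambda>x. a * v x + b * w x)"
  unfolding L1_approximable_def
proof (intro conjI allI impI)
  have i: "integrable M v" "integrable M w" using assms unfolding L1_approximable_def by auto
  then show "integrable M (\<lambda>x. a * v x + b * w x)" by auto
  fix e :: real assume e: "0 < e"
  define d where "d = e / (\<bar>a\<bar> + \<bar>b\<bar> + 1)"
  have d: "0 < d" using e unfolding d_def by (simp add: add_nonneg_pos)
  obtain f g where fg: "continuous_on UNIV f" "(\<integral>x. \<bar>v x - f x\<bar> \<partial>M) < d"
    "continuous_on UNIV g" "(\<integral>x. \<bar>w x - g x\<bar> \<partial>M) < d"
    using assms d unfolding L1_approximable_def by blast
  have ifg: "integrable M f" "integrable M g" using fg continuous_integrable by auto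
  have "(\<integral>x. \<bar>(a * v x + b * w x) - (a * f x + b * g x)\<bar> \<partial>M)
    \<le> (\<integral>x. \<bar>a\<bar> * \<bar>v x - f x\<bar> + \<bar>b\<bar> * \<bar>w x - g x\<bar> \<partial>M)"
  proof (rule integral_mono)
    fix x
    have "(a * v x + b * w x) - (a * f x + b * g x) = a * (v x - f x) + b * (w x - g x)"
      by (simp add: algebra_simps)
    then show "\<bar>(a * v x + b * w x) - (a * f x + b * g x)\<bar> \<le> \<bar>a\<bar> * \<bar>v x - f x\<bar> + \<bar>b\<bar> * \<bar>w x - g x\<bar>"
      by (metis abs_mult abs_triangle_ineq)
  qed (use i ifg in auto)
  also have "\<dots> = \<bar>a\<bar> * (\<integral>x. \<bar>v x - f x\<bar> \<partial>M) + \<bar>b\<bar> * (\<integral>x. \<bar>w x - g x\<bar> \<partial>M)"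
    using i ifg by simp
  also have "\<dots> \<le> \<bar>a\<bar> * d + \<bar>b\<bar> * d"
    using fg by (intro add_mono mult_left_mono) auto
  also have "\<dots> = e - d"
  proof -
    have "(\<bar>a\<bar> + \<bar>b\<bar> + 1) * d = e"
      unfolding d_def by (simp add: add_nonneg_eq_0_iff)
    then show ?thesis by (simp add: algebra_simps)
  qed
  also have "\<dots> < e" using d by simp
  finally show "\<exists>f. continuous_on UNIV f \<and> (\<integral>x. \<bar>(a * v x + b * w x) - f x\<bar> \<partial>M) < e"
    using fg by (intro exI[of _ "\<lambda>x. a * f x + b * g x"]) (auto intro!: continuous_intros)
qed

lemma L1_approximable_lim:
  assumes s: "\<And>i::nat. L1_approximable (s i)" and v: "integrable M v"
    and lim: "(\<lambda>i. \<integral>x. \<bar>v x - s i x\<bar> \<partial>M) \<longlonglongrightarrow> 0"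
  shows "L1_approximable v"
  unfolding L1_approximable_def
proof (intro conjI allI impI v)
  fix e :: real assume e: "0 < e"
  then have "\<forall>\<^sub>F i in sequentially. (\<integral>x. \<bar>v x - s i x\<bar> \<partial>M) < e/2"
    by (intro order_tendstoD(2)[OF lim]) auto
  then obtain i where i: "(\<integral>x. \<bar>v x - s i x\<bar> \<partial>M) < e/2"
    by (meson eventually_happens trivial_limit_sequentially)
  obtain f where f: "continuous_on UNIV f" "(\<integral>x. \<bar>s i x - f x\<bar> \<partial>M) < e/2"
    using s[of i] e unfolding L1_approximable_def by (meson half_gt_zero)
  have int: "integrable M (s i)" "integrable M f"
    using s continuous_integrable[OF f(1)] unfolding L1_approximable_def by auto
  have "(\<integral>x. \<bar>v x - f x\<bar> \<partial>M) \<le> (\<integral>x. \<bar>v x - s i x\<bar> + \<bar>s i x - f x\<bar> \<partial>M)"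
    using v int by (intro integral_mono) auto
  also have "\<dots> = (\<integral>x. \<bar>v x - s i x\<bar> \<partial>M) + (\<integral>x. \<bar>s i x - f x\<bar> \<partial>M)"
    using v int by simp
  also have "\<dots> < e" using i f by simp
  finally show "\<exists>f. continuous_on UNIV f \<and> (\<integral>x. \<bar>v x - f x\<bar> \<partial>M) < e" using f by blast
qed

text \<open>The open sets are an intersection-stable generator of the Borel sets, and approximability
survives complements and countable disjoint unions.\<close>

lemma indicator_approximable:
  assumes "A \<in> sets M"
  shows "L1_approximable (indicator A)"
proof -
  have one: "L1_approximable (\<lambda>x. 1)"
    unfolding L1_approximable_def by (auto intro!: exI[of _ "\<lambda>x. 1"])
  have int: "integrable M (indicat_real A)" if "A \<in> sets M" for A
    using that by (simp add: fmeasurable_eq_sets integrable_real_indicator emeasure_finite less_top[symmetric])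
  have sub: "sigma_sets UNIV {S. open S} = sets M"
    using sets_M by (simp add: borel_def sets_measure_of)
  have "Int_stable {S :: 'a set. open S}" by (auto simp: Int_stable_def)
  moreover have "{S :: 'a set. open S} \<subseteq> Pow UNIV" by blast
  moreover have "A \<in> sigma_sets UNIV {S. open S}"
    using assms sub by simp
  ultimately show ?thesis
  proof (induction rule: sigma_sets_induct_disjoint)
    case (basic U)
    then show ?case using indicator_open_approx int open_sets_M unfolding L1_approximable_def by blast
  next
    case empty
    have "L1_approximable (\<lambda>x. 0 * 1 + 0 * 1)" by (rule L1_approximable_lincomb[OF one one])
    then show ?case by (simp add: indicator_def)
  next
    case (compl A)
    have "L1_approximable (\<lambda>x. 1 * 1 + (-1) * indicator A x)"
      by (rule L1_approximable_lincomb[OF one compl.IH])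
    moreover have "(\<lambda>x. 1 * 1 + (-1) * indicator A x) = indicat_real (UNIV - A)"
      by (auto simp: indicator_def)
    ultimately show ?case by simp
  next
    case (union A)
    have A: "A i \<in> sets M" for i using union(2) sub by blast
    define s where "s n x = indicat_real (\<Union>i<n. A i) x" for n x
    have "L1_approximable (s n)" for n
    proof (induction n)
      case 0
      have "L1_approximable (\<lambda>x. 0 * 1 + 0 * 1)" by (rule L1_approximable_lincomb[OF one one])
      then show ?case by (simp add: indicator_def s_def)
    next
      case (Suc n)
      have "L1_approximable (\<lambda>x. 1 * s n x + 1 * indicator (A n) x)"
        by (rule L1_approximable_lincomb[OF Suc union(3)])
      moreover have "(\<lambda>x. 1 * s n x + 1 * indicator (A n) x) = s (Suc n)"
      proof
        fix x
        have "(\<Union>i<n. A i) \<inter> A n = {}"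
        proof -
          have "A i \<inter> A n = {}" if "i < n" for i
            by (rule disjoint_family_onD[OF union(1)]) (use that in auto)
          then show ?thesis by blast
        qed
        then show "1 * s n x + 1 * indicator (A n) x = s (Suc n) x"
          unfolding s_def lessThan_Suc by (auto simp: indicator_def)
      qed
      ultimately show ?case by simp
    qed
    moreover have "(\<lambda>n. \<integral>x. \<bar>indicator (\<Union>i. A i) x - s n x\<bar> \<partial>M) \<longlonglongrightarrow> (\<integral>x. (0::real) \<partial>M)"
    proof (rule integral_dominated_convergence[where w = "\<lambda>_. 1"])
      show "(\<lambda>x. \<bar>indicat_real (\<Union>i. A i) x - s n x\<bar>) \<in> borel_measurable M" for n
        unfolding s_def using A
        by (intro borel_measurable_abs borel_measurable_diff borel_measurable_indicator) auto
      show "AE x in M. norm \<bar>indicat_real (\<Union>i. A i) x - s n x\<bar> \<le> 1" for n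
        unfolding s_def by (auto simp: indicator_def)
      show "AE x in M. (\<lambda>n. \<bar>indicat_real (\<Union>i. A i) x - s n x\<bar>) \<longlonglongrightarrow> 0"
      proof (rule AE_I2)
        fix x
        have "\<forall>\<^sub>F n in sequentially. \<bar>indicat_real (\<Union>i. A i) x - s n x\<bar> = 0"
        proof (cases "x \<in> (\<Union>i. A i)")
          case True
          then obtain i where "x \<in> A i" by blast
          then have "\<bar>indicat_real (\<Union>i. A i) x - s n x\<bar> = 0" if "n \<ge> Suc i" for n
            using that unfolding s_def by (auto simp: indicator_def)
          then show ?thesis using eventually_sequentially by blast
        qed (simp add: s_def)
        then show "(\<lambda>n. \<bar>indicat_real (\<Union>i. A i) x - s n x\<bar>) \<longlonglongrightarrow> 0"
          by (rule tendsto_eventually)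
      qed
    qed auto
    moreover have "integrable M (indicat_real (\<Union>i. A i))"
      using A by (intro int) blast
    ultimately show ?case using L1_approximable_lim[of s "indicator (\<Union> (range A))"] by simp
  qed
qed

lemma integrable_approximable:
  fixes v :: "'a \<Rightarrow> real"
  assumes "integrable M v"
  shows "L1_approximable v"
  using assms
proof (induction rule: integrable_induct)
  case (base A c)
  have "L1_approximable (\<lambda>x. c * indicator A x + 0 * indicator A x)"
    by (rule L1_approximable_lincomb) (rule indicator_approximable[OF base(1)])+
  then show ?case by (simp add: mult.commute[of c])
next
  case (add f g)
  then show ?case using L1_approximable_lincomb[of f g 1 1] by simp
next
  case (lim f s)
  have s_le: "norm (s i x) \<le> 2 * norm (f x)" and s_lim: "(\<lambda>i. s i x) \<longlonglongrightarrow> f x" for i x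
    using lim by (simp_all add: space_M)
  have int: "integrable M (s i)" "integrable M f" for i
    using lim by blast+
  have ap: "L1_approximable (s i)" for i
    using lim by blast
  have "(\<lambda>i. \<integral>x. \<bar>f x - s i x\<bar> \<partial>M) \<longlonglongrightarrow> (\<integral>x. (0::real) \<partial>M)"
  proof (rule integral_dominated_convergence[where w = "\<lambda>x. 3 * \<bar>f x\<bar>"])
    show "AE x in M. norm \<bar>f x - s i x\<bar> \<le> 3 * \<bar>f x\<bar>" for i
    proof (rule AE_I2)
      fix x assume "x \<in> space M"
      then show "norm \<bar>f x - s i x\<bar> \<le> 3 * \<bar>f x\<bar>" using s_le[of i x] by simp
    qed
    show "AE x in M. (\<lambda>i. \<bar>f x - s i x\<bar>) \<longlonglongrightarrow> 0"
    proof (rule AE_I2)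
      fix x
      have "(\<lambda>i. \<bar>f x - s i x\<bar>) \<longlonglongrightarrow> \<bar>f x - f x\<bar>"
        by (intro tendsto_intros s_lim)
      then show "(\<lambda>i. \<bar>f x - s i x\<bar>) \<longlonglongrightarrow> 0" by simp
    qed
  qed (use int in auto)
  then have "(\<lambda>i. \<integral>x. \<bar>f x - s i x\<bar> \<partial>M) \<longlonglongrightarrow> 0" by simp
  then show ?case by (rule L1_approximable_lim[OF ap int(2)])
qed

section \<open>Spreading a function over the space by translation\<close>

text \<open>The average of the right-hand side over the group would be at least half the integral of \<open>v\<close>.
The factor one quarter leaves room for three errors of at most a twelfth each: in the mean of the
continuous approximant, in the choice of its translate, and in the integral of that translate.\<close>

lemma translate_integral_ge:
  fixes v :: "'a \<Rightarrow> real"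
  assumes v: "integrable M v" and A: "A \<in> sets M" and big: "measure M UNIV \<le> 2 * measure M A"
    and pos: "0 < (\<integral>x. v x \<partial>M)"
  shows "\<exists>\<Omega>\<in>G. (\<integral>x. v x \<partial>M) / 4 \<le> (\<integral>x. indicator A x * v (\<Omega> x) \<partial>M)"
proof -
  define I where "I = (\<integral>x. v x \<partial>M)"
  define \<mu> where "\<mu> = measure M UNIV"
  have \<mu>: "0 < \<mu>" and I: "0 < I" using measure_pos pos unfolding \<mu>_def I_def by auto
  obtain f where f: "continuous_on UNIV f" "(\<integral>x. \<bar>v x - f x\<bar> \<partial>M) < I / 12"
    using integrable_approximable[OF v] I unfolding L1_approximable_def
    by (metis divide_pos_pos zero_less_numeral)
  note fi = continuous_integrable[OF f(1)]
  have ifI: "(\<integral>x. f x \<partial>M) \<ge> I - I/12"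
  proof -
    have "I - (\<integral>x. f x \<partial>M) = (\<integral>x. v x - f x \<partial>M)" using v fi by (simp add: I_def)
    also have "\<dots> \<le> (\<integral>x. \<bar>v x - f x\<bar> \<partial>M)" using v fi by (intro integral_mono) auto
    finally show ?thesis using f by simp
  qed
  obtain \<Omega> where \<Omega>: "\<Omega> \<in> G" "((\<integral>x. f x \<partial>M) / \<mu> - I / (12 * \<mu>)) * measure M A
    \<le> (\<integral>x. indicator A x * f (\<Omega> x) \<partial>M)"
    using translate_integral_ge_continuous[OF f(1) A, of "I / (12 * \<mu>)"] I \<mu> unfolding \<mu>_def by auto
  have "(I - I/12 - I/12) / \<mu> * (\<mu> / 2) \<le> ((\<integral>x. f x \<partial>M) / \<mu> - I / (12 * \<mu>)) * measure M A"
  proof (rule mult_mono)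
    have "(\<integral>x. f x \<partial>M) / \<mu> - I / (12 * \<mu>) = ((\<integral>x. f x \<partial>M) - I/12) / \<mu>"
      by (simp add: diff_divide_distrib)
    then show *: "(I - I/12 - I/12) / \<mu> \<le> (\<integral>x. f x \<partial>M) / \<mu> - I / (12 * \<mu>)"
      using divide_right_mono[of "I - I/12 - I/12" "(\<integral>x. f x \<partial>M) - I/12" \<mu>] ifI \<mu> by simp
    have "0 \<le> (I - I/12 - I/12) / \<mu>" using I \<mu> by simp
    then show "0 \<le> (\<integral>x. f x \<partial>M) / \<mu> - I / (12 * \<mu>)" using * by linarith
  qed (use big \<mu> in \<open>auto simp: \<mu>_def\<close>)
  moreover have "(I - I/12 - I/12) / \<mu> * (\<mu> / 2) = 5 * I / 12" using \<mu> by simp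
  moreover have "(\<integral>x. indicator A x * f (\<Omega> x) \<partial>M) - (\<integral>x. indicator A x * v (\<Omega> x) \<partial>M) \<le> I/12"
  proof -
    have vt: "integrable M (\<lambda>x. v (\<Omega> x))" and ft: "integrable M (\<lambda>x. f (\<Omega> x))"
      using integrable_translate \<Omega>(1) v fi by auto
    have ind: "integrable M (\<lambda>x. indicator A x * w x)" if "integrable M w" for w :: "'a \<Rightarrow> real"
      using integrable_mult_indicator[OF A that] by simp
    have "(\<integral>x. indicator A x * f (\<Omega> x) \<partial>M) - (\<integral>x. indicator A x * v (\<Omega> x) \<partial>M)
      = (\<integral>x. indicator A x * f (\<Omega> x) - indicator A x * v (\<Omega> x) \<partial>M)"
      using ind[OF vt] ind[OF ft] by simp
    also have "\<dots> \<le> (\<integral>x. \<bar>v (\<Omega> x) - f (\<Omega> x)\<bar> \<partial>M)"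
      using ind[OF vt] ind[OF ft] vt ft by (intro integral_mono) (auto simp: indicator_def)
    also have "\<dots> = (\<integral>x. \<bar>v x - f x\<bar> \<partial>M)"
      using v fi by (intro integral_translate[OF \<Omega>(1)]) auto
    finally show ?thesis using f(2) by simp
  qed
  moreover have "5 * I / 12 \<le> (\<integral>x. indicator A x * f (\<Omega> x) \<partial>M)"
    using calculation(1) \<Omega>(2) unfolding calculation(2) by (rule order_trans)
  ultimately have "I / 4 \<le> (\<integral>x. indicator A x * v (\<Omega> x) \<partial>M)" using I by argo
  then show ?thesis using \<Omega>(1) unfolding I_def by blast
qed

text \<open>Greedy choice. The translates selected so far live on a set of measure at most \<open>N\<close> times that
of \<open>E\<close>, hence on at most half of the space, so that a further translate has a quarter of its integral
where their maximum vanishes.\<close>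

lemma spread_translates:
  fixes v :: "'a \<Rightarrow> real"
  assumes v: "integrable M v" "\<And>x. 0 \<le> v x" and E: "E \<in> sets M" "\<And>x. x \<notin> E \<Longrightarrow> v x = 0"
    and pos: "0 < (\<integral>x. v x \<partial>M)"
    and N: "(real N - 1) * measure M E \<le> measure M UNIV / 2"
  shows "\<exists>L. length L = N \<and> set L \<subseteq> G \<and> integrable M (\<lambda>x. max_list (\<lambda>\<Omega>. v (\<Omega> x)) L) \<and>
    real N / 4 * (\<integral>x. v x \<partial>M) \<le> (\<integral>x. max_list (\<lambda>\<Omega>. v (\<Omega> x)) L \<partial>M)"
  using N
proof (induction N)
  case 0
  show ?case by (rule exI[of _ "[]"]) simp
next
  case (Suc N)
  have "(real N - 1) * measure M E \<le> measure M UNIV / 2"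
    using Suc.prems by (rule order_trans[rotated]) (auto intro!: mult_right_mono)
  then obtain L where L: "length L = N" "set L \<subseteq> G" "integrable M (\<lambda>x. max_list (\<lambda>\<Omega>. v (\<Omega> x)) L)"
    "real N / 4 * (\<integral>x. v x \<partial>M) \<le> (\<integral>x. max_list (\<lambda>\<Omega>. v (\<Omega> x)) L \<partial>M)"
    using Suc.IH by blast
  define B where "B = (\<Union>\<Omega>\<in>set L. \<Omega> -` E)"
  have B: "B \<in> sets M" unfolding B_def using measure_translate(1) E L(2) by (intro sets.finite_UN) auto
  have "measure M B \<le> (\<Sum>\<Omega>\<in>set L. measure M (\<Omega> -` E))"
    unfolding B_def using measure_translate(1) E L(2)
    by (intro measure_subadditive_finite) auto
  also have "\<dots> = real (card (set L)) * measure M E"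
    using measure_translate(2) E L(2) by (simp add: subset_iff)
  also have "\<dots> \<le> real N * measure M E"
    using L(1) card_length[of L] by (intro mult_right_mono) auto
  finally have "measure M B \<le> measure M UNIV / 2" using Suc.prems by simp
  moreover have "measure M (UNIV - B) = measure M UNIV - measure M B"
    using finite_measure_compl[OF B] by (simp add: space_M)
  moreover have cB: "UNIV - B \<in> sets M" using sets.compl_sets[OF B] by (simp add: space_M)
  ultimately obtain \<Omega> where \<Omega>: "\<Omega> \<in> G"
    "(\<integral>x. v x \<partial>M) / 4 \<le> (\<integral>x. indicator (UNIV - B) x * v (\<Omega> x) \<partial>M)"
    using translate_integral_ge[OF v(1) cB _ pos] by auto
  let ?m = "\<lambda>L x. max_list (\<lambda>\<Omega>. v (\<Omega> x)) L"
  have off: "?m L x = 0" if "x \<notin> B" for x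
  proof -
    have "max_list (\<lambda>\<Omega>. v (\<Omega> x)) K = 0" if "set K \<subseteq> set L" for K
      using that E(2) \<open>x \<notin> B\<close> unfolding B_def by (induction K) auto
    then show ?thesis by blast
  qed
  have vt: "integrable M (\<lambda>x. v (\<Omega> x))" by (rule integrable_translate[OF \<Omega>(1) v(1)])
  have int: "integrable M (?m (\<Omega> # L))" using vt L(3) by simp
  have ind: "integrable M (\<lambda>x. indicator (UNIV - B) x * v (\<Omega> x))"
    using integrable_mult_indicator[OF cB vt] by simp
  have "real (Suc N) / 4 * (\<integral>x. v x \<partial>M)
    \<le> (\<integral>x. ?m L x \<partial>M) + (\<integral>x. indicator (UNIV - B) x * v (\<Omega> x) \<partial>M)"
    using L(4) \<Omega>(2) by (simp add: add_divide_distrib distrib_right)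
  also have "\<dots> = (\<integral>x. ?m L x + indicator (UNIV - B) x * v (\<Omega> x) \<partial>M)"
    using L(3) ind by simp
  also have "\<dots> \<le> (\<integral>x. ?m (\<Omega> # L) x \<partial>M)"
    using L(3) ind int off by (intro integral_mono) (auto simp: indicator_def)
  finally show ?case using L \<Omega> int by (intro exI[of _ "\<Omega> # L"]) auto
qed

end

section \<open>Randomised sums of translates\<close>

text \<open>For a proportion \<open>w \<in> [0,1]\<close>, \<open>w \<le> w powr s\<close>; this is applied to the two proportions of \<open>u + v\<close>.\<close>

lemma powr_add_subadditive:
  fixes u v s :: real
  assumes "0 \<le> u" "0 \<le> v" "0 < s" "s \<le> 1"
  shows "(u + v) powr s \<le> u powr s + v powr s"
proof (cases "u + v = 0")
  case True
  then show ?thesis by simp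
next
  case False
  then have pos: "0 < u + v" using assms by linarith
  have le: "w / (u + v) \<le> (w / (u + v)) powr s" if "0 \<le> w" "w \<le> u + v" for w
  proof -
    have "(w / (u + v)) powr 1 \<le> (w / (u + v)) powr s"
      using that pos assms by (intro powr_mono') auto
    then show ?thesis using that pos by simp
  qed
  have "1 = u / (u + v) + v / (u + v)" using pos by (simp add: add_divide_distrib[symmetric])
  also have "\<dots> \<le> (u / (u + v)) powr s + (v / (u + v)) powr s"
    using le assms by (intro add_mono) auto
  also have "\<dots> = (u powr s + v powr s) / (u + v) powr s"
    using assms by (simp add: powr_divide add_divide_distrib)
  finally show ?thesis using pos by (simp add: le_divide_eq)
qed

text \<open>At \<open>q = 2\<close> this is the parallelogram identity. For \<open>q < 2\<close>, the power mean inequality with exponent \<open>q/2\<close> bounds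
the left side by twice the \<open>q/2\<close>-th power of \<open>|a|\<^sup>2 + |b|\<^sup>2\<close>, and that power is subadditive.\<close>

lemma two_point_inequality:
  fixes a b :: complex
  assumes q: "1 \<le> q" "q \<le> 2"
  shows "norm (a + b) powr q + norm (a - b) powr q \<le> 2 * (norm a powr q + norm b powr q)"
proof (cases "a = 0 \<and> b = 0")
  case True
  then show ?thesis by simp
next
  case False
  define s where "s = q / 2"
  have s: "0 < s" "s \<le> 1" using q unfolding s_def by auto
  define m where "m = (norm a)\<^sup>2 + (norm b)\<^sup>2"
  have m: "0 < m" using False unfolding m_def by (auto simp: sum_power2_gt_zero_iff)
  have sq: "(x\<^sup>2) powr s = x powr q" if "0 \<le> x" for x :: real
    using that by (cases "x = 0") (auto simp: s_def powr_def ln_realpow)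
  have tangent: "x powr s \<le> m powr s * (s * (x / m) + (1 - s))" if "0 \<le> x" for x
  proof (cases "x = 0")
    case False
    have "(x / m) powr s * 1 powr (1 - s) \<le> s * (x / m) + (1 - s) * 1"
      using Youngs_inequality_0[of s "1 - s" "x / m" 1] s m that False by simp
    then have "x powr s / m powr s \<le> s * (x / m) + (1 - s)"
      using that m by (simp add: powr_divide)
    then show ?thesis using m by (simp add: divide_le_eq mult.commute)
  qed (use s in simp)
  have par: "(norm (a + b))\<^sup>2 + (norm (a - b))\<^sup>2 = 2 * m"
    unfolding m_def cmod_power2 by (simp add: power2_eq_square algebra_simps)
  have "norm (a + b) powr q + norm (a - b) powr q
      = ((norm (a + b))\<^sup>2) powr s + ((norm (a - b))\<^sup>2) powr s"
    by (simp add: sq)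
  also have "\<dots> \<le> m powr s * (s * ((norm (a + b))\<^sup>2 / m) + (1 - s))
      + m powr s * (s * ((norm (a - b))\<^sup>2 / m) + (1 - s))"
    by (intro add_mono tangent) auto
  also have "\<dots> = m powr s * (s * (((norm (a + b))\<^sup>2 + (norm (a - b))\<^sup>2) / m) + 2 * (1 - s))"
    by (simp add: algebra_simps add_divide_distrib)
  also have "\<dots> = 2 * m powr s" unfolding par using m by (simp add: field_simps)
  also have "\<dots> \<le> 2 * (((norm a)\<^sup>2) powr s + ((norm b)\<^sup>2) powr s)"
    unfolding m_def using s by (intro mult_left_mono powr_add_subadditive) auto
  also have "\<dots> = 2 * (norm a powr q + norm b powr q)" by (simp add: sq)
  finally show ?thesis .
qed

lemma Lp_space_lincomb:
  assumes q: "1 \<le> q" "q \<le> 2" and f: "f \<in> Lp_space q M" and h: "h \<in> Lp_space q M"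
  shows "(\<lambda>x. a * f x + b * h x) \<in> Lp_space q M"
proof -
  have [measurable]: "f \<in> borel_measurable M" "h \<in> borel_measurable M"
    using f h unfolding Lp_space_def by auto
  have bound: "norm (a * f x + b * h x) powr q
      \<le> 2 * (norm a powr q * norm (f x) powr q + norm b powr q * norm (h x) powr q)" for x
    using two_point_inequality[OF q, of "a * f x" "b * h x"]
    by (smt (verit) norm_mult powr_mult norm_ge_zero powr_ge_zero)
  have "integrable M (\<lambda>x. 2 * (norm a powr q * norm (f x) powr q + norm b powr q * norm (h x) powr q))"
    using f h unfolding Lp_space_def by auto
  then have "integrable M (\<lambda>x. norm (a * f x + b * h x) powr q)"
    by (rule Bochner_Integration.integrable_bound) (use bound in auto)
  then show ?thesis unfolding Lp_space_def by auto
qed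

context
  fixes M :: "'a measure" and q :: real and T :: "('a \<Rightarrow> complex) \<Rightarrow> ('a \<Rightarrow> complex)"
  assumes q: "1 \<le> q" "q \<le> 2"
    and lin: "linear_operator_on (Lp_space q M) M T"
    and TL1: "\<And>f. f \<in> Lp_space q M \<Longrightarrow> T f \<in> Lp_space 1 M"
begin

lemma image_norm_integrable:
  assumes "f \<in> Lp_space q M"
  shows "integrable M (\<lambda>x. norm (T f x))"
  using TL1[OF assms] unfolding Lp_space_def by simp

lemma max_images_integrable:
  assumes "set fs \<subseteq> Lp_space q M"
  shows "integrable M (\<lambda>x. max_list (\<lambda>f. norm (T f x)) fs)"
  using assms by (induction fs) (auto intro: image_norm_integrable)

text \<open>This replaces the first moment of a randomly signed sum. In the induction step the functions
\<open>g + f\<close> and \<open>g - f\<close> take the role of \<open>g\<close> for the shorter list. Their images average pointwise to at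
least both \<open>|T g|\<close> and \<open>|T f|\<close>, while their \<open>q\<close>-th moments average to at most the sum of those
of \<open>g\<close> and \<open>f\<close>.\<close>

lemma max_images_le:
  assumes bound: "\<And>F. F \<in> Lp_space q M \<Longrightarrow>
      (\<integral>x. norm (T F x) \<partial>M) \<le> c + d * (\<integral>x. norm (F x) powr q \<partial>M)"
    and d: "0 \<le> d"
  shows "g \<in> Lp_space q M \<Longrightarrow> set fs \<subseteq> Lp_space q M \<Longrightarrow>
    (\<integral>x. max_list (\<lambda>f. norm (T f x)) (g # fs) \<partial>M)
      \<le> c + d * (\<Sum>f\<leftarrow>g # fs. \<integral>x. norm (f x) powr q \<partial>M)"
proof (induction fs arbitrary: g)
  case Nil
  have "max_list (\<lambda>f. norm (T f x)) [g] = norm (T g x)" for x by simp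
  then show ?case using bound[OF Nil(1)] by simp
next
  case (Cons f fs)
  let ?m = "\<lambda>fs x. max_list (\<lambda>f. norm (T f x)) fs"
  let ?I = "\<lambda>f. \<integral>x. norm (f x) powr q \<partial>M"
  define p where "p = (\<lambda>x. 1 * g x + 1 * f x)"
  define n where "n = (\<lambda>x. 1 * g x + (-1) * f x)"
  have f: "f \<in> Lp_space q M" and fs: "set fs \<subseteq> Lp_space q M" using Cons.prems by auto
  have p: "p \<in> Lp_space q M" and n: "n \<in> Lp_space q M"
    unfolding p_def n_def using Lp_space_lincomb[OF q] Cons.prems(1) f by blast+
  have powi: "integrable M (\<lambda>x. norm (F x) powr q)" if "F \<in> Lp_space q M" for F
    using that unfolding Lp_space_def by simp
  have "AE x in M. T p x = 1 * T g x + 1 * T f x"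
    unfolding p_def using lin f Cons.prems(1) unfolding linear_operator_on_def by blast
  moreover have "AE x in M. T n x = 1 * T g x + (-1) * T f x"
    unfolding n_def using lin f Cons.prems(1) unfolding linear_operator_on_def by blast
  ultimately have "AE x in M. ?m (g # f # fs) x \<le> (?m (p # fs) x + ?m (n # fs) x) / 2"
  proof eventually_elim
    case (elim x)
    have "2 * norm (T g x) = norm (T p x + T n x)" "2 * norm (T f x) = norm (T p x - T n x)"
      unfolding elim by (simp_all add: norm_mult flip: mult_2)
    then have "2 * norm (T g x) \<le> norm (T p x) + norm (T n x)"
      "2 * norm (T f x) \<le> norm (T p x) + norm (T n x)"
      by (metis norm_triangle_ineq, metis norm_triangle_ineq4)
    then show ?case by auto
  qed
  then have "(\<integral>x. ?m (g # f # fs) x \<partial>M) \<le> (\<integral>x. (?m (p # fs) x + ?m (n # fs) x) / 2 \<partial>M)"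
    using max_images_integrable[of "g # f # fs"] max_images_integrable[of "p # fs"]
      max_images_integrable[of "n # fs"] Cons.prems p n
    by (intro integral_mono_AE) auto
  also have "\<dots> = ((\<integral>x. ?m (p # fs) x \<partial>M) + (\<integral>x. ?m (n # fs) x \<partial>M)) / 2"
    using max_images_integrable[of "p # fs"] max_images_integrable[of "n # fs"] fs p n
    by simp
  also have "\<dots> \<le> ((c + d * (\<Sum>f\<leftarrow>p # fs. ?I f)) + (c + d * (\<Sum>f\<leftarrow>n # fs. ?I f))) / 2"
    using Cons.IH[OF p fs] Cons.IH[OF n fs] by (intro divide_right_mono add_mono) auto
  also have "\<dots> = c + d * ((?I p + ?I n) / 2 + (\<Sum>f\<leftarrow>fs. ?I f))"
    by (simp add: field_simps)
  also have "\<dots> \<le> c + d * ((?I g + ?I f) + (\<Sum>f\<leftarrow>fs. ?I f))"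
  proof -
    have "?I p + ?I n = (\<integral>x. norm (g x + f x) powr q + norm (g x - f x) powr q \<partial>M)"
      using powi[OF p] powi[OF n] by (simp add: p_def n_def)
    also have "\<dots> \<le> (\<integral>x. 2 * (norm (g x) powr q + norm (f x) powr q) \<partial>M)"
      using powi[OF p] powi[OF n] powi[OF f] powi[OF Cons.prems(1)]
      by (intro integral_mono two_point_inequality q) (simp_all add: p_def n_def)
    also have "\<dots> = 2 * (?I g + ?I f)"
      using powi[OF f] powi[OF Cons.prems(1)] by simp
    finally show ?thesis using d by (intro add_left_mono mult_left_mono) auto
  qed
  finally show ?case by (simp add: add.assoc)
qed

end

context compact_homogeneous_space
begin

text \<open>The number \<open>N\<close> of translates is chosen so that \<open>N\<close> times the measure of the level set is at least
half of the total mass, but \<open>N - 1\<close> times this measure at most half, and \<open>max_images_le\<close> is applied to the translates of \<open>f\<close>. The term of the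
bound that is linear in \<open>s\<close> is absorbed: by Chebyshev's inequality the measure of the level
set is at most the left-hand side divided by \<open>l\<close>, and for the chosen \<open>s\<close> the term amounts to at most half of
the left-hand side.

The bound on \<open>T\<close> is stated with a free parameter \<open>s\<close> because this form is linear in the
\<open>q\<close>-th moment and can be averaged over signs; optimising in \<open>s\<close> would give the norm bound.\<close>

lemma level_set_estimate:
  fixes T :: "('a \<Rightarrow> complex) \<Rightarrow> ('a \<Rightarrow> complex)"
  assumes q: "1 \<le> q" "q \<le> 2"
    and lin: "linear_operator_on (Lp_space q M) M T"
    and inv: "translation_invariant_on (Lp_space q M) M G T"
    and TL1: "\<And>f. f \<in> Lp_space q M \<Longrightarrow> T f \<in> Lp_space 1 M"
    and \<kappa>: "0 < \<kappa>"
    and bound: "\<And>F s. F \<in> Lp_space q M \<Longrightarrow> 0 < s \<Longrightarrow>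
      (\<integral>x. norm (T F x) \<partial>M) \<le> \<kappa> * (s + s powr (1 - q) * (\<integral>x. norm (F x) powr q \<partial>M))"
    and f: "f \<in> Lp_space q M" and l: "0 < l"
  shows "(\<integral>x. norm (T f x) * indicator {x. l \<le> norm (T f x)} x \<partial>M)
    \<le> 8 * \<kappa> * (16 * \<kappa> / (measure M UNIV * l)) powr (q - 1) * (\<integral>x. norm (f x) powr q \<partial>M)"
proof -
  define h where "h x = norm (T f x)" for x
  define E where "E = {x. l \<le> h x}"
  define v where "v x = h x * indicator E x" for x
  define I where "I = (\<integral>x. v x \<partial>M)"
  define X where "X = (\<integral>x. norm (f x) powr q \<partial>M)"
  define \<mu> where "\<mu> = measure M UNIV"
  \<comment> \<open>the value of \<open>s\<close> that makes the linear term below at most half of the left-hand side\<close>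
  define s where "s = \<mu> * l / (16 * \<kappa>)"
  have \<mu>: "0 < \<mu>" unfolding \<mu>_def by (rule measure_pos)
  have s: "0 < s" using \<mu> l \<kappa> unfolding s_def by simp
  have X: "0 \<le> X" unfolding X_def by simp
  have hi: "integrable M h" unfolding h_def by (rule image_norm_integrable[OF q lin TL1 f])
  then have [measurable]: "h \<in> borel_measurable M" by simp
  have E: "E \<in> sets M"
  proof -
    have "{x \<in> space M. l \<le> h x} \<in> sets M" by measurable
    then show ?thesis by (simp add: E_def space_M)
  qed
  have vi: "integrable M v"
    unfolding v_def using integrable_mult_indicator[OF E hi] by (simp add: mult.commute)
  have v: "0 \<le> v x" "v x \<le> h x" "x \<notin> E \<Longrightarrow> v x = 0" for x
    unfolding v_def h_def by (auto simp: indicator_def)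
  have "I \<le> 8 * \<kappa> * (1 / s) powr (q - 1) * X"
  proof (cases "0 < I")
    case False
    moreover have "0 \<le> 8 * \<kappa> * (1 / s) powr (q - 1) * X" using \<kappa> X by simp
    ultimately show ?thesis by linarith
  next
    case True
    define \<delta> where "\<delta> = measure M E"
    have "l * \<delta> \<le> I"
    proof -
      have "l * \<delta> = (\<integral>x. l * indicator E x \<partial>M)" using E by (simp add: \<delta>_def space_M)
      also have "\<dots> \<le> I" unfolding I_def
      proof (intro integral_mono vi)
        show "integrable M (\<lambda>x. l * indicator E x)"
          using E by (intro integrable_mult_right) (simp add: emeasure_finite less_top[symmetric])
      qed (auto simp: v_def E_def indicator_def)
      finally show ?thesis .
    qed
    have \<delta>: "0 < \<delta>"
    proof (rule ccontr)
      assume "\<not> 0 < \<delta>"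
      then have "E \<in> null_sets M"
        using E measure_nonneg[of M E] by (auto simp: \<delta>_def emeasure_eq_measure intro!: null_setsI)
      from AE_not_in[OF this] have "AE x in M. v x = 0"
        by eventually_elim (simp add: v)
      then have "I = 0" unfolding I_def by (rule integral_eq_zero_AE)
      then show False using True by simp
    qed
    \<comment> \<open>Adding 1 makes \<open>N\<close> positive even when the level set is large; \<open>spread_translates\<close> only
      constrains \<open>N - 1\<close>.\<close>
    define N where "N = nat \<lfloor>\<mu> / (2 * \<delta>)\<rfloor> + 1"
    have N1: "real N - 1 \<le> \<mu> / (2 * \<delta>)" and N2: "\<mu> / (2 * \<delta>) \<le> real N"
      unfolding N_def using \<mu> \<delta> by (auto simp: of_nat_nat) linarith+
    have Npos: "0 < real N" unfolding N_def by simp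
    have "(real N - 1) * measure M E \<le> measure M UNIV / 2"
      using mult_right_mono[OF N1, of \<delta>] \<delta> unfolding \<delta>_def[symmetric] \<mu>_def[symmetric] by simp
    then obtain L where L: "length L = N" "set L \<subseteq> G"
      "integrable M (\<lambda>x. max_list (\<lambda>\<Omega>. v (\<Omega> x)) L)"
      "real N / 4 * I \<le> (\<integral>x. max_list (\<lambda>\<Omega>. v (\<Omega> x)) L \<partial>M)"
      using spread_translates[OF vi v(1) E v(3), of N] True unfolding I_def by blast
    define fs where "fs = map (\<lambda>\<Omega>. f \<circ> \<Omega>) L"
    have trans: "f \<circ> \<Omega> \<in> Lp_space q M" "(\<integral>x. norm ((f \<circ> \<Omega>) x) powr q \<partial>M) = X"
      if "\<Omega> \<in> G" for \<Omega>
    proof -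
      have fm: "f \<in> borel_measurable M" "integrable M (\<lambda>x. norm (f x) powr q)"
        using f unfolding Lp_space_def by auto
      show "f \<circ> \<Omega> \<in> Lp_space q M"
        unfolding Lp_space_def
        using measurable_comp[OF measurable_G[OF that] fm(1)] integrable_translate[OF that fm(2)]
        by (simp add: o_def)
      show "(\<integral>x. norm ((f \<circ> \<Omega>) x) powr q \<partial>M) = X"
        unfolding X_def using integral_translate[OF that, of "\<lambda>x. norm (f x) powr q"] fm(2) by simp
    qed
    have fs: "set fs \<subseteq> Lp_space q M" unfolding fs_def using trans L(2) by auto
    have zero: "(\<lambda>x. 0) \<in> Lp_space q M" unfolding Lp_space_def by simp
    have "AE x in M. \<forall>\<Omega>\<in>set L. T (f \<circ> \<Omega>) x = (T f \<circ> \<Omega>) x"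
      using inv f L(2) unfolding translation_invariant_on_def by (intro AE_finite_allI) auto
    then have "AE x in M. max_list (\<lambda>\<Omega>. v (\<Omega> x)) L
        \<le> max_list (\<lambda>F. norm (T F x)) ((\<lambda>x. 0) # fs)"
    proof eventually_elim
      case (elim x)
      have "max_list (\<lambda>\<Omega>. v (\<Omega> x)) L \<le> max_list (\<lambda>\<Omega>. norm (T (f \<circ> \<Omega>) x)) L"
        using elim v(2) by (intro max_list_mono) (auto simp: h_def)
      then show ?case by (simp add: fs_def max_list_map)
    qed
    then have "(\<integral>x. max_list (\<lambda>\<Omega>. v (\<Omega> x)) L \<partial>M)
        \<le> (\<integral>x. max_list (\<lambda>F. norm (T F x)) ((\<lambda>x. 0) # fs) \<partial>M)"
      using L(3) max_images_integrable[OF q lin TL1, of "(\<lambda>x. 0) # fs"] fs zero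
      by (intro integral_mono_AE) auto
    also have "\<dots> \<le> \<kappa> * s + \<kappa> * s powr (1 - q) *
        (\<Sum>F\<leftarrow>(\<lambda>x. 0) # fs. \<integral>x. norm (F x) powr q \<partial>M)"
    proof (rule max_images_le[OF q lin TL1])
      show "(\<integral>x. norm (T F x) \<partial>M) \<le> \<kappa> * s + \<kappa> * s powr (1 - q) * (\<integral>x. norm (F x) powr q \<partial>M)"
        if "F \<in> Lp_space q M" for F
        using bound[OF that s] by (simp add: distrib_left mult.assoc)
    qed (use \<kappa> zero fs in auto)
    also have "(\<Sum>F\<leftarrow>(\<lambda>x. 0) # fs. \<integral>x. norm (F x) powr q \<partial>M) = real N * X"
    proof -
      have "map (\<lambda>F. \<integral>x. norm (F x) powr q \<partial>M) fs = map (\<lambda>_. X) L"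
        unfolding fs_def map_map using trans(2) L(2) by (intro map_cong) auto
      then show ?thesis using L(1) by (simp add: sum_list_triv)
    qed
    finally have "real N * I \<le> 4 * \<kappa> * s + real N * (4 * \<kappa> * s powr (1 - q) * X)"
      using L(4) by (simp add: algebra_simps)
    also have "4 * \<kappa> * s \<le> real N * (I / 2)"
    proof -
      have "4 * \<kappa> * s = \<mu> / (2 * \<delta>) * (l * \<delta>) / 2"
        unfolding s_def using \<kappa> \<delta> by simp
      also have "\<dots> \<le> real N * I / 2"
        using N2 \<open>l * \<delta> \<le> I\<close> \<mu> \<delta> l by (intro divide_right_mono mult_mono) auto
      finally show ?thesis by simp
    qed
    finally have "real N * I \<le> real N * (I / 2 + 4 * \<kappa> * s powr (1 - q) * X)"
      by (simp add: algebra_simps)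
    then have "I \<le> I / 2 + 4 * \<kappa> * s powr (1 - q) * X"
      using Npos by (simp only: mult_le_cancel_left_pos)
    moreover have "s powr (1 - q) = (1 / s) powr (q - 1)"
      using s by (simp add: powr_divide powr_minus_divide[symmetric])
    ultimately show ?thesis by simp
  qed
  moreover have "1 / s = 16 * \<kappa> / (\<mu> * l)" unfolding s_def by simp
  ultimately show ?thesis unfolding I_def X_def v_def h_def E_def \<mu>_def by simp
qed

end

section \<open>The spaces $L\log^r L$ and $L^p$\<close>

text \<open>The infimum that defines the operator norm is attained.\<close>

lemma operator_norm_bound:
  assumes T: "bounded_operator V nV W nW T" and nonneg: "\<And>f. f \<in> V \<Longrightarrow> 0 \<le> nV f"
  shows "0 \<le> operator_norm V nV nW T"
    and "f \<in> V \<Longrightarrow> nW (T f) \<le> operator_norm V nV nW T * nV f"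
proof -
  define S where "S = {K. 0 \<le> K \<and> (\<forall>f\<in>V. nW (T f) \<le> K * nV f)}"
  obtain K where "\<forall>f\<in>V. nW (T f) \<le> K * nV f" using T unfolding bounded_operator_def by blast
  then have "\<forall>f\<in>V. nW (T f) \<le> \<bar>K\<bar> * nV f"
    using nonneg by (meson abs_ge_self mult_right_mono order_trans)
  then have ne: "\<bar>K\<bar> \<in> S" unfolding S_def by simp
  have op: "operator_norm V nV nW T = Inf S" unfolding operator_norm_def S_def ..
  show "0 \<le> operator_norm V nV nW T"
    unfolding op
  proof (rule cInf_greatest)
    show "0 \<le> K" if "K \<in> S" for K using that unfolding S_def by simp
  qed (use ne in blast)
  show "nW (T f) \<le> operator_norm V nV nW T * nV f" if f: "f \<in> V"
  proof (cases "nV f = 0")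
    case True
    then show ?thesis using ne f unfolding S_def by fastforce
  next
    case False
    then have pos: "0 < nV f" using nonneg[OF f] by simp
    have "nW (T f) / nV f \<le> Inf S"
    proof (rule cInf_greatest)
      show "nW (T f) / nV f \<le> K" if "K \<in> S" for K
        using that f pos unfolding S_def by (simp add: divide_le_eq)
    qed (use ne in blast)
    then show ?thesis unfolding op using pos by (simp add: divide_le_eq)
  qed
qed

text \<open>The function whose Luxemburg norm is the norm of $L\log^r L$.\<close>

definition llog :: "real \<Rightarrow> real \<Rightarrow> real" where
  "llog r u = u * ln (2 + u) powr r"

lemma llog_nonneg: "0 \<le> u \<Longrightarrow> 0 \<le> llog r u"
  unfolding llog_def by simp

lemma llog_scale:
  assumes "0 \<le> u" "1 \<le> l" "0 \<le> r"
  shows "llog r (u / l) \<le> llog r u / l"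
proof -
  have "u / l \<le> u" using assms by (simp add: divide_le_eq mult_right_le_one_le mult_le_cancel_left1)
  moreover have "0 \<le> u / l" using assms by simp
  ultimately have "ln (2 + u / l) \<le> ln (2 + u)" "0 \<le> ln (2 + u / l)" by auto
  then have "ln (2 + u / l) powr r \<le> ln (2 + u) powr r"
    using assms by (intro powr_mono2)
  then have "u / l * ln (2 + u / l) powr r \<le> u / l * ln (2 + u) powr r"
    using assms by (intro mult_left_mono) auto
  then show ?thesis unfolding llog_def by simp
qed

text \<open>This is where the factor \<open>(q - 1) powr (- r)\<close> arises: \<open>ln t \<le> t powr a / a\<close> with \<open>a = (q - 1) / r\<close>, raised
to the power \<open>r\<close>.\<close>

lemma llog_le_powr:
  assumes u: "0 \<le> u" and r: "0 < r" and q: "1 < q" "q \<le> 2"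
  shows "llog r u \<le> 16 * r powr r * (q - 1) powr (- r) * (1 + u powr q)"
proof -
  define a where "a = (q - 1) / r"
  have a: "0 < a" using q r unfolding a_def by simp
  have "ln (2 + u) powr r \<le> ((2 + u) powr a / a) powr r"
    using u r a by (intro powr_mono2 ln_powr_bound) (auto simp: ln_ge_zero)
  also have "\<dots> = (2 + u) powr (q - 1) * (r powr r * (q - 1) powr (- r))"
  proof -
    have "((2 + u) powr a / a) powr r = (2 + u) powr (a * r) * (1 / a) powr r"
      using u a by (simp add: powr_divide powr_powr)
    moreover have "a * r = q - 1" "1 / a = r / (q - 1)" using r unfolding a_def by auto
    ultimately show ?thesis using r q by (simp add: powr_divide powr_minus_divide)
  qed
  finally have "llog r u \<le> u * ((2 + u) powr (q - 1) * (r powr r * (q - 1) powr (- r)))"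
    unfolding llog_def using u by (intro mult_left_mono) auto
  also have "\<dots> \<le> (2 + u) * ((2 + u) powr (q - 1) * (r powr r * (q - 1) powr (- r)))"
    by (intro mult_right_mono) auto
  also have "\<dots> = r powr r * (q - 1) powr (- r) * (2 + u) powr q"
    using u by (simp add: powr_diff field_simps)
  also have "\<dots> \<le> r powr r * (q - 1) powr (- r) * (16 * (1 + u powr q))"
  proof (rule mult_left_mono)
    have "(2 + u) powr q \<le> (2 * max 2 u) powr q"
      using u q by (intro powr_mono2) auto
    also have "\<dots> = 2 powr q * max 2 u powr q" using u by (simp add: powr_mult)
    also have "\<dots> \<le> 4 * (4 + u powr q)"
    proof (rule mult_mono)
      show "2 powr q \<le> (4::real)" using powr_mono[of q 2 2] q by simp
      then show "max 2 u powr q \<le> 4 + u powr q" by (cases "2 \<le> u") (auto simp: max_def add_increasing add_increasing2)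
    qed auto
    also have "\<dots> \<le> 16 * (1 + u powr q)" by simp
    finally show "(2 + u) powr q \<le> 16 * (1 + u powr q)" .
  qed simp
  finally show ?thesis by (simp add: algebra_simps)
qed

lemma LlogL_norm_le:
  assumes "0 < l" "(\<integral>\<^sup>+x. ennreal (llog r (norm (f x) / l)) \<partial>M) \<le> 1"
  shows "LlogL_norm r M f \<le> l"
  unfolding LlogL_norm_def
  using assms by (intro cInf_lower bdd_belowI[of _ 0]) (auto simp: llog_def)

text \<open>An infimum of positive numbers, of which there is at least one: the integral of
\<open>llog r (|f| / l)\<close> is at most \<open>1 / l\<close> times that of \<open>llog r |f|\<close> when \<open>l \<ge> 1\<close>.\<close>

lemma LlogL_norm_nonneg:
  assumes f: "f \<in> LlogL_space r M" and r: "0 < r"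
  shows "0 \<le> LlogL_norm r M f"
proof -
  have [measurable]: "f \<in> borel_measurable M" using f unfolding LlogL_space_def by blast
  define Z where "Z = (\<integral>\<^sup>+x. ennreal (llog r (norm (f x))) \<partial>M)"
  have fin: "Z < \<infinity>" using f unfolding LlogL_space_def Z_def llog_def by simp
  define l where "l = max 1 (enn2real Z)"
  have l: "1 \<le> l" unfolding l_def by simp
  have Zl: "Z \<le> ennreal l"
    using fin unfolding l_def by (cases Z) (auto intro!: ennreal_leI)
  have "(\<integral>\<^sup>+x. ennreal (llog r (norm (f x) / l)) \<partial>M) \<le> (\<integral>\<^sup>+x. ennreal (1 / l) * ennreal (llog r (norm (f x))) \<partial>M)"
    using l r llog_scale[OF norm_ge_zero l, of r]
    by (intro nn_integral_mono) (auto simp: ennreal_mult[symmetric] llog_nonneg intro!: ennreal_leI)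
  also have "\<dots> = ennreal (1 / l) * Z"
    unfolding Z_def llog_def by (intro nn_integral_cmult) measurable
  also have "\<dots> \<le> ennreal (1 / l) * ennreal l" using Zl by (intro mult_left_mono) auto
  also have "\<dots> = 1" using l by (simp add: ennreal_mult[symmetric])
  finally have "l \<in> {l. 0 < l \<and>
     (\<integral>\<^sup>+x. ennreal (norm (f x) / l * ln (2 + norm (f x) / l) powr r) \<partial>M) \<le> 1}"
    using l by (simp add: llog_def)
  then show ?thesis unfolding LlogL_norm_def by (intro cInf_greatest) auto
qed

text \<open>With \<open>t = s + s powr (1 - q) * Z\<close>, where \<open>Z\<close> is the \<open>q\<close>-th moment of \<open>f\<close>, the \<open>q\<close>-th moment
of \<open>f / t\<close> is at most 1, so that \<open>llog_le_powr\<close> bounds the integral of \<open>llog r (|f| / t)\<close>; dividing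
further by this bound normalises it to 1.\<close>

lemma Lp_space_subset_LlogL:
  assumes M: "finite_measure M" and r: "0 < r" and q: "1 < q" "q \<le> 2" and f: "f \<in> Lp_space q M"
  shows "f \<in> LlogL_space r M"
    and "0 < s \<Longrightarrow> LlogL_norm r M f
      \<le> (1 + 16 * r powr r * (measure M (space M) + 1)) * (q - 1) powr (- r)
        * (s + s powr (1 - q) * (\<integral>x. norm (f x) powr q \<partial>M))"
proof -
  interpret finite_measure M by (rule M)
  define \<mu> where "\<mu> = measure M (space M)"
  define b where "b = (q - 1) powr (- r)"
  define D where "D = 16 * r powr r * b"
  define Z where "Z = (\<integral>x. norm (f x) powr q \<partial>M)"
  have [measurable]: "f \<in> borel_measurable M" and fi: "integrable M (\<lambda>x. norm (f x) powr q)"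
    using f unfolding Lp_space_def by auto
  have \<mu>: "0 \<le> \<mu>" unfolding \<mu>_def by simp
  have b: "1 \<le> b" using powr_mono'[of "- r" 0 "q - 1"] q r unfolding b_def by simp
  have D: "0 \<le> D" unfolding D_def using b by simp
  have Z: "0 \<le> Z" unfolding Z_def by simp
  have key: "(\<integral>\<^sup>+x. ennreal (llog r (norm (f x) / t)) \<partial>M) \<le> ennreal (D * (\<mu> + Z / t powr q))"
    if t: "0 < t" for t
  proof -
    have "(\<integral>\<^sup>+x. ennreal (llog r (norm (f x) / t)) \<partial>M)
        \<le> (\<integral>\<^sup>+x. ennreal (D * (1 + norm (f x) powr q / t powr q)) \<partial>M)"
    proof (intro nn_integral_mono ennreal_leI)
      fix x
      show "llog r (norm (f x) / t) \<le> D * (1 + norm (f x) powr q / t powr q)"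
        using llog_le_powr[of "norm (f x) / t" r q] t r q by (simp add: D_def b_def powr_divide)
    qed
    also have "\<dots> = ennreal (\<integral>x. D * (1 + norm (f x) powr q / t powr q) \<partial>M)"
      using fi D by (intro nn_integral_eq_integral) auto
    also have "(\<integral>x. D * (1 + norm (f x) powr q / t powr q) \<partial>M) = D * (\<mu> + Z / t powr q)"
      using fi by (simp add: \<mu>_def Z_def)
    finally show ?thesis .
  qed
  show "f \<in> LlogL_space r M"
    using key[of 1] unfolding LlogL_space_def llog_def
    by (auto simp: less_top[symmetric] top_unique)
  assume s: "0 < s"
  define t where "t = s + s powr (1 - q) * Z"
  have st: "s \<le> t" unfolding t_def using Z by simp
  then have t: "0 < t" using s by simp
  define A where "A = (1 + 16 * r powr r * (\<mu> + 1)) * b"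
  have "1 * 1 \<le> A" unfolding A_def using b \<mu> by (intro mult_mono) auto
  then have A1: "1 \<le> A" by simp
  have A2: "D * (\<mu> + 1) \<le> A" unfolding A_def D_def using b by (simp add: algebra_simps)
  have "Z * s powr (1 - q) \<le> t" unfolding t_def using s by (simp add: mult.commute)
  then have "Z \<le> t * s powr (q - 1)"
    using s by (simp add: powr_diff field_simps)
  also have "\<dots> \<le> t * t powr (q - 1)"
    using st s t q by (intro mult_left_mono powr_mono2) auto
  also have "\<dots> = t powr q" using t by (simp add: powr_diff)
  finally have Zt: "Z / t powr q \<le> 1" using t by (simp add: divide_le_eq)
  have "LlogL_norm r M f \<le> A * t"
  proof (rule LlogL_norm_le)
    show "0 < A * t" using A1 t by simp
    have "(\<integral>\<^sup>+x. ennreal (llog r (norm (f x) / (A * t))) \<partial>M)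
        \<le> (\<integral>\<^sup>+x. ennreal (1 / A) * ennreal (llog r (norm (f x) / t)) \<partial>M)"
    proof (intro nn_integral_mono)
      fix x
      have "llog r (norm (f x) / t / A) \<le> llog r (norm (f x) / t) / A"
        using t A1 r by (intro llog_scale) auto
      then show "ennreal (llog r (norm (f x) / (A * t))) \<le> ennreal (1 / A) * ennreal (llog r (norm (f x) / t))"
        using A1 t by (auto simp: ennreal_mult[symmetric] llog_nonneg mult.commute intro!: ennreal_leI)
    qed
    also have "\<dots> = ennreal (1 / A) * (\<integral>\<^sup>+x. ennreal (llog r (norm (f x) / t)) \<partial>M)"
      unfolding llog_def by (intro nn_integral_cmult) measurable
    also have "\<dots> \<le> ennreal (1 / A) * ennreal (D * (\<mu> + Z / t powr q))"
      using key[OF t] by (intro mult_left_mono) auto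
    also have "\<dots> \<le> ennreal (1 / A) * ennreal A"
    proof (intro mult_left_mono ennreal_leI)
      have "D * (\<mu> + Z / t powr q) \<le> D * (\<mu> + 1)" using D Zt by (intro mult_left_mono) auto
      then show "D * (\<mu> + Z / t powr q) \<le> A" using A2 by simp
    qed simp
    also have "\<dots> = 1" using A1 by (simp add: ennreal_mult[symmetric])
    finally show "(\<integral>\<^sup>+x. ennreal (llog r (norm (f x) / (A * t))) \<partial>M) \<le> 1" .
  qed
  then show "LlogL_norm r M f \<le> (1 + 16 * r powr r * (measure M (space M) + 1)) * (q - 1) powr (- r)
        * (s + s powr (1 - q) * (\<integral>x. norm (f x) powr q \<partial>M))"
    unfolding A_def t_def Z_def \<mu>_def b_def .
qed

section \<open>Real interpolation without loss at the endpoints\<close>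

lemma nn_integral_powr_from_0:
  fixes a c :: real
  assumes a: "-1 < a" and c: "0 \<le> c"
  shows "(\<integral>\<^sup>+s. ennreal (if 0 \<le> s \<and> s \<le> c then s powr a else 0) \<partial>lborel) = ennreal (c powr (a + 1) / (a + 1))"
proof (rule nn_integral_has_integral_lborel)
  have "((\<lambda>s. if s \<in> {0..c} then s powr a else 0) has_integral (c powr (a + 1) / (a + 1))) UNIV"
    unfolding has_integral_restrict_UNIV by (rule has_integral_powr_from_0[OF a c])
  then show "((\<lambda>s. if 0 \<le> s \<and> s \<le> c then s powr a else 0) has_integral (c powr (a + 1) / (a + 1))) UNIV"
    by simp
qed auto

lemma nn_integral_powr_to_inf:
  fixes a c :: real
  assumes a: "a < -1" and c: "0 < c"
  shows "(\<integral>\<^sup>+s. ennreal (if c < s then s powr a else 0) \<partial>lborel) = ennreal (c powr (a + 1) / (- a - 1))"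
proof -
  have "((\<lambda>s. if s \<in> {c..} then s powr a else 0) has_integral (-(c powr (a + 1)) / (a + 1))) UNIV"
    unfolding has_integral_restrict_UNIV by (rule has_integral_powr_to_inf[OF a c])
  moreover have "-(c powr (a + 1)) / (a + 1) = c powr (a + 1) / (- a - 1)"
    using a by (simp add: field_simps)
  ultimately have "((\<lambda>s. if c \<le> s then s powr a else 0) has_integral (c powr (a + 1) / (- a - 1))) UNIV"
    by simp
  then have "(\<integral>\<^sup>+s. ennreal (if c \<le> s then s powr a else 0) \<partial>lborel) = ennreal (c powr (a + 1) / (- a - 1))"
    by (intro nn_integral_has_integral_lborel) auto
  moreover have "(\<integral>\<^sup>+s. ennreal (if c < s then s powr a else 0) \<partial>lborel)
      = (\<integral>\<^sup>+s. ennreal (if c \<le> s then s powr a else 0) \<partial>lborel)"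
    using AE_lborel_singleton[of c] by (intro nn_integral_cong_AE) (auto elim: eventually_mono)
  ultimately show ?thesis by simp
qed

text \<open>Interpolation compares integrals of \<open>min_power b (|h| / l)\<close> for all \<open>l\<close>. The first power
for large values and the power \<open>b\<close> for small ones are those of the two endpoint spaces.\<close>

definition min_power :: "real \<Rightarrow> real \<Rightarrow> real" where
  "min_power b t = min t (t powr b)"

lemma min_power_nonneg: "0 \<le> t \<Longrightarrow> 0 \<le> min_power b t"
  unfolding min_power_def by simp

lemma min_power_mono: "1 \<le> b \<Longrightarrow> 0 \<le> t \<Longrightarrow> t \<le> u \<Longrightarrow> min_power b t \<le> min_power b u"
  unfolding min_power_def by (intro min.mono powr_mono2) auto

lemma min_power_add:
  assumes b: "1 \<le> b" and t: "0 \<le> t" "0 \<le> u"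
  shows "min_power b (t + u) \<le> 2 powr b * (min_power b t + min_power b u)"
proof -
  define m where "m = max t u"
  have m: "0 \<le> m" using t unfolding m_def by simp
  have "2 powr 1 \<le> 2 powr b" using b by (intro powr_mono) auto
  then have two: "2 \<le> 2 powr b" by simp
  have "min_power b (t + u) \<le> min_power b (2 * m)"
    using t by (intro min_power_mono b) (auto simp: m_def)
  also have "\<dots> \<le> min (2 powr b * m) (2 powr b * m powr b)"
    unfolding min_power_def using m two by (auto simp: powr_mult min.coboundedI1 mult_right_mono intro!: min.mono)
  also have "\<dots> = 2 powr b * min_power b m"
    unfolding min_power_def by (simp add: min_mult_distrib_left)
  also have "min_power b m \<le> min_power b t + min_power b u"
    using min_power_nonneg[of t b] min_power_nonneg[of u b] t by (auto simp: m_def max_def)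
  finally show ?thesis by simp
qed

lemma min_power_layer_cake:
  fixes b l y :: real
  assumes b: "1 < b" and l: "0 < l" and y: "0 \<le> y"
  shows "ennreal (min_power b (y / l)) = ennreal ((b - 1) * l powr (- b)) *
    (\<integral>\<^sup>+s. ennreal (if 0 \<le> s \<and> s \<le> l \<and> s \<le> y then y * s powr (b - 2) else 0) \<partial>lborel)"
proof -
  define m where "m = min l y"
  have m: "0 \<le> m" using l y unfolding m_def by simp
  have "(\<integral>\<^sup>+s. ennreal (if 0 \<le> s \<and> s \<le> l \<and> s \<le> y then y * s powr (b - 2) else 0) \<partial>lborel)
      = (\<integral>\<^sup>+s. ennreal y * ennreal (if 0 \<le> s \<and> s \<le> m then s powr (b - 2) else 0) \<partial>lborel)"
    using y by (intro nn_integral_cong) (auto simp: m_def ennreal_mult)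
  also have "\<dots> = ennreal y * ennreal (m powr (b - 1) / (b - 1))"
    using nn_integral_powr_from_0[of "b - 2" m] b m by (simp add: nn_integral_cmult)
  also have "ennreal ((b - 1) * l powr (- b)) * (ennreal y * ennreal (m powr (b - 1) / (b - 1)))
      = ennreal (l powr (- b) * (y * m powr (b - 1)))"
    using b y by (simp add: ennreal_mult[symmetric])
  also have "l powr (- b) * (y * m powr (b - 1)) = min_power b (y / l)"
  proof (cases "l \<le> y")
    case True
    then have "(y / l) powr 1 \<le> (y / l) powr b" using l b by (intro powr_mono) auto
    then have "min_power b (y / l) = y / l" using True l unfolding min_power_def by simp
    moreover have "m = l" using True unfolding m_def by simp
    ultimately show ?thesis using l by (simp add: powr_diff powr_minus field_simps)
  next
    case False
    then have "(y / l) powr b \<le> (y / l) powr 1" using l b y by (intro powr_mono') auto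
    then have "min_power b (y / l) = (y / l) powr b" using y l unfolding min_power_def by simp
    moreover have "m = y" using False unfolding m_def by simp
    ultimately show ?thesis using l y by (cases "y = 0") (auto simp: powr_diff powr_minus powr_divide field_simps)
  qed
  finally show ?thesis by simp
qed

text \<open>Integrate the hypothesis over the levels \<open>s \<le> l\<close> with the weight of \<open>min_power_layer_cake\<close>. The
resulting factor \<open>(b - 1) / (b - q)\<close> is at most 2.\<close>

lemma level_sets_imp_min_power:
  fixes h :: "'a \<Rightarrow> real"
  assumes M: "sigma_finite_measure M" and h[measurable]: "h \<in> borel_measurable M" and h0: "\<And>x. 0 \<le> h x"
    and q: "1 < q" "q < b" "b - 1 \<le> 2 * (b - q)" and l: "0 < l"
    and weak: "\<And>s. 0 < s \<Longrightarrow>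
      (\<integral>\<^sup>+x. ennreal (if s \<le> h x then h x else 0) \<partial>M) \<le> ennreal (s powr (1 - q)) * Z"
  shows "(\<integral>\<^sup>+x. ennreal (min_power b (h x / l)) \<partial>M) \<le> ennreal (2 * l powr (- q)) * Z"
proof -
  interpret sigma_finite_measure M by (rule M)
  interpret pair_sigma_finite lborel M by standard
  define k where "k s x = ennreal (if 0 \<le> s \<and> s \<le> l \<and> s \<le> h x then h x * s powr (b - 2) else 0)" for s :: real and x
  define c where "c = (b - 1) * l powr (- b)"
  have [measurable]: "case_prod k \<in> borel_measurable (lborel \<Otimes>\<^sub>M M)"
    unfolding k_def case_prod_beta by measurable
  have c: "0 \<le> c" using q unfolding c_def by simp
  have "(\<integral>\<^sup>+x. ennreal (min_power b (h x / l)) \<partial>M) = (\<integral>\<^sup>+x. ennreal c * (\<integral>\<^sup>+s. k s x \<partial>lborel) \<partial>M)"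
    unfolding c_def k_def using min_power_layer_cake[OF _ l h0] q by simp
  also have "\<dots> = ennreal c * (\<integral>\<^sup>+s. (\<integral>\<^sup>+x. k s x \<partial>M) \<partial>lborel)"
    by (subst nn_integral_cmult) (auto simp: Fubini')
  also have "(\<integral>\<^sup>+s. (\<integral>\<^sup>+x. k s x \<partial>M) \<partial>lborel)
      \<le> (\<integral>\<^sup>+s. ennreal (if 0 \<le> s \<and> s \<le> l then s powr (b - 1 - q) else 0) * Z \<partial>lborel)"
  proof (rule nn_integral_mono)
    fix s :: real
    show "(\<integral>\<^sup>+x. k s x \<partial>M) \<le> ennreal (if 0 \<le> s \<and> s \<le> l then s powr (b - 1 - q) else 0) * Z"
    proof (cases "0 < s \<and> s \<le> l")
      case True
      then have "(\<integral>\<^sup>+x. k s x \<partial>M)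
          = (\<integral>\<^sup>+x. ennreal (s powr (b - 2)) * ennreal (if s \<le> h x then h x else 0) \<partial>M)"
        unfolding k_def using h0 by (intro nn_integral_cong) (auto simp: ennreal_mult mult.commute)
      also have "\<dots> \<le> ennreal (s powr (b - 2)) * (ennreal (s powr (1 - q)) * Z)"
        using weak[of s] True by (subst nn_integral_cmult) (auto intro!: mult_left_mono)
      also have "\<dots> = ennreal (s powr (b - 2) * s powr (1 - q)) * Z"
        by (simp add: ennreal_mult mult.assoc)
      also have "s powr (b - 2) * s powr (1 - q) = s powr (b - 1 - q)"
        using powr_add[of s "b - 2" "1 - q"] by (simp add: algebra_simps)
      finally show ?thesis using True by simp
    next
      case False
      then have "k s x = 0" for x unfolding k_def by auto
      then show ?thesis by simp
    qed
  qed
  also have "\<dots> = ennreal (l powr (b - q) / (b - q)) * Z"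
    using nn_integral_powr_from_0[of "b - 1 - q" l] q l by (subst nn_integral_multc) auto
  also have "ennreal c * (ennreal (l powr (b - q) / (b - q)) * Z) = ennreal (c * (l powr (b - q) / (b - q))) * Z"
  proof -
    have "0 \<le> l powr (b - q) / (b - q)" using q by simp
    from ennreal_mult[OF c this] show ?thesis by (simp only: mult.assoc)
  qed
  also have "\<dots> \<le> ennreal (2 * l powr (- q)) * Z"
  proof (intro mult_right_mono ennreal_leI)
    have "c * (l powr (b - q) / (b - q)) = (b - 1) / (b - q) * l powr (- q)"
      unfolding c_def using powr_add[of l "- b" "b - q"] by simp
    also have "\<dots> \<le> 2 * l powr (- q)"
      using q by (intro mult_right_mono) (auto simp: divide_le_eq)
    finally show "c * (l powr (b - q) / (b - q)) \<le> 2 * l powr (- q)" .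
  qed simp
  finally show ?thesis by (simp add: mult_left_mono)
qed

text \<open>The part \<open>l \<le> y\<close> contributes the first summand of the constant, the part \<open>l > y\<close> the second.\<close>

lemma min_power_scale_integral:
  fixes p b y :: real
  assumes p: "1 < p" "p < b" and y: "0 \<le> y"
  shows "(\<integral>\<^sup>+l. ennreal (if 0 < l then l powr (p - 1) * min_power b (y / l) else 0) \<partial>lborel)
    = ennreal ((1 / (p - 1) + 1 / (b - p)) * y powr p)"
proof (cases "y = 0")
  case True
  then have "(if 0 < l then l powr (p - 1) * min_power b (y / l) else 0) = 0" for l
    by (simp add: min_power_def)
  then show ?thesis using True by simp
next
  case False
  then have y: "0 < y" using y by simp
  have "ennreal (if 0 < l then l powr (p - 1) * min_power b (y / l) else 0)
      = ennreal y * ennreal (if 0 \<le> l \<and> l \<le> y then l powr (p - 2) else 0)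
      + ennreal (y powr b) * ennreal (if y < l then l powr (p - 1 - b) else 0)" (is "_ = ?R l") for l
  proof -
    consider "l \<le> 0" | "0 < l" "l \<le> y" | "y < l" by linarith
    then show ?thesis
    proof cases
      case 1
      then show ?thesis using y by auto
    next
      case 2
      then have "(y / l) powr 1 \<le> (y / l) powr b" using p by (intro powr_mono) auto
      then have "min_power b (y / l) = y / l" using 2 y unfolding min_power_def by simp
      moreover have "l powr (p - 1) = l * l powr (p - 2)"
        using powr_mult_base[of l "p - 2"] 2 by simp
      ultimately have "l powr (p - 1) * min_power b (y / l) = y * l powr (p - 2)"
        using 2 by simp
      then show ?thesis using 2 y by (simp add: ennreal_mult)
    next
      case 3
      then have l: "0 < l" using y by simp
      have "(y / l) powr b \<le> (y / l) powr 1" using p y l 3 by (intro powr_mono') auto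
      then have "min_power b (y / l) = (y / l) powr b" using y l unfolding min_power_def by simp
      moreover have "l powr (p - 1 - b) = l powr (p - 1) / l powr b" by (rule powr_diff)
      ultimately have "l powr (p - 1) * min_power b (y / l) = y powr b * l powr (p - 1 - b)"
        using l y by (simp add: powr_divide)
      then show ?thesis using 3 l y by (simp add: ennreal_mult)
    qed
  qed
  then have "(\<integral>\<^sup>+l. ennreal (if 0 < l then l powr (p - 1) * min_power b (y / l) else 0) \<partial>lborel)
      = (\<integral>\<^sup>+l. ?R l \<partial>lborel)" by simp
  also have "\<dots> = ennreal y * ennreal (y powr (p - 1) / (p - 1)) + ennreal (y powr b) * ennreal (y powr (p - b) / (b - p))"
    using nn_integral_powr_from_0[of "p - 2" y] nn_integral_powr_to_inf[of "p - 1 - b" y] p y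
    by (simp add: nn_integral_add nn_integral_cmult)
  also have "\<dots> = ennreal (y * (y powr (p - 1) / (p - 1)) + y powr b * (y powr (p - b) / (b - p)))"
    using y p by (simp add: ennreal_mult[symmetric] ennreal_plus[symmetric] del: ennreal_plus)
  also have "y * (y powr (p - 1) / (p - 1)) + y powr b * (y powr (p - b) / (b - p)) = (1 / (p - 1) + 1 / (b - p)) * y powr p"
    using y powr_mult_base[of y "p - 1"] powr_add[of y b "p - b"] by (simp add: distrib_right)
  finally show ?thesis .
qed

lemma ennreal_lincomb_common_factor:
  assumes "0 \<le> k" "0 \<le> a" "0 \<le> x" "0 \<le> d" "0 \<le> y"
  shows "ennreal k * (ennreal a * (ennreal x * U) + ennreal d * (ennreal y * U))
    = ennreal (k * (a * x + d * y)) * U"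
  using assms by (simp add: ennreal_mult distrib_left distrib_right mult.assoc)

text \<open>The estimates for the splitting at height \<open>l\<close> are integrated against
\<open>l powr (p - 1)\<close>. Each endpoint contributes a constant that diverges as \<open>p\<close> approaches it, and
\<open>min_power_scale_integral\<close> yields a constant \<open>c\<close> on the left that diverges at the same rates. The
conclusion is therefore uniform in \<open>p\<close>.\<close>

lemma interpolation:
  fixes h u :: "'a \<Rightarrow> real"
  assumes M: "sigma_finite_measure M"
    and h[measurable]: "h \<in> borel_measurable M" and h0: "\<And>x. 0 \<le> h x"
    and u[measurable]: "u \<in> borel_measurable M" and u0: "\<And>x. 0 \<le> u x"
    and pb: "1 < p" "p < b" and q: "1 < q" "p - 1 \<le> 2 * (p - q)" "b - 1 \<le> 2 * (b - q)"
    and Q: "0 \<le> Q" and R: "0 \<le> R"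
    and split: "\<And>l. 0 < l \<Longrightarrow> \<exists>h1 h2. h1 \<in> borel_measurable M \<and> h2 \<in> borel_measurable M \<and>
      (\<forall>x. 0 \<le> h1 x) \<and> (\<forall>x. 0 \<le> h2 x) \<and> (AE x in M. h x \<le> h1 x + h2 x) \<and>
      (\<forall>s>0. (\<integral>\<^sup>+x. ennreal (if s \<le> h1 x then h1 x else 0) \<partial>M)
        \<le> ennreal (s powr (1 - q)) * (ennreal Q * (\<integral>\<^sup>+x. ennreal (if l \<le> u x then u x powr q else 0) \<partial>M))) \<and>
      (\<integral>\<^sup>+x. ennreal (h2 x powr b) \<partial>M) \<le> ennreal R * (\<integral>\<^sup>+x. ennreal (if u x < l then u x powr b else 0) \<partial>M)"
  shows "(\<integral>\<^sup>+x. ennreal (h x powr p) \<partial>M) \<le> ennreal (2 powr b * (4 * Q + R)) * (\<integral>\<^sup>+x. ennreal (u x powr p) \<partial>M)"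
proof -
  interpret sigma_finite_measure M by (rule M)
  interpret pair_sigma_finite lborel M by standard
  have qp: "q < p" and qb: "q < b" using pb q by auto
  define X where "X l = (\<integral>\<^sup>+x. ennreal (if l \<le> u x then u x powr q else 0) \<partial>M)" for l :: real
  define Y where "Y l = (\<integral>\<^sup>+x. ennreal (if u x < l then u x powr b else 0) \<partial>M)" for l :: real
  define U where "U = (\<integral>\<^sup>+x. ennreal (u x powr p) \<partial>M)"
  define c where "c = 1 / (p - 1) + 1 / (b - p)"
  have c: "0 < c" unfolding c_def using pb by (simp add: add_pos_pos)
  have [measurable]: "X \<in> borel_measurable lborel" "Y \<in> borel_measurable lborel"
    unfolding X_def Y_def by measurable
  have one: "(\<integral>\<^sup>+x. ennreal (min_power b (h x / l)) \<partial>M)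
      \<le> ennreal (2 powr b) * (ennreal (2 * Q * l powr (- q)) * X l + ennreal (R * l powr (- b)) * Y l)"
    if l: "0 < l" for l
  proof -
    obtain h1 h2 where m[measurable]: "h1 \<in> borel_measurable M" "h2 \<in> borel_measurable M"
      and nn: "\<And>x. 0 \<le> h1 x" "\<And>x. 0 \<le> h2 x" and le: "AE x in M. h x \<le> h1 x + h2 x"
      and w1: "\<And>s. 0 < s \<Longrightarrow> (\<integral>\<^sup>+x. ennreal (if s \<le> h1 x then h1 x else 0) \<partial>M)
        \<le> ennreal (s powr (1 - q)) * (ennreal Q * X l)"
      and w2: "(\<integral>\<^sup>+x. ennreal (h2 x powr b) \<partial>M) \<le> ennreal R * Y l"
      using split[OF l] unfolding X_def Y_def by blast
    have [measurable]: "(\<lambda>x. min_power b (v x / l)) \<in> borel_measurable M" if "v \<in> borel_measurable M" for v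
      using that unfolding min_power_def by measurable
    have "(\<integral>\<^sup>+x. ennreal (min_power b (h x / l)) \<partial>M)
        \<le> (\<integral>\<^sup>+x. ennreal (2 powr b) * (ennreal (min_power b (h1 x / l)) + ennreal (min_power b (h2 x / l))) \<partial>M)"
    proof (rule nn_integral_mono_AE)
      show "AE x in M. ennreal (min_power b (h x / l))
        \<le> ennreal (2 powr b) * (ennreal (min_power b (h1 x / l)) + ennreal (min_power b (h2 x / l)))"
        using le
      proof eventually_elim
        case (elim x)
        have "min_power b (h x / l) \<le> min_power b (h1 x / l + h2 x / l)"
          using elim l h0 pb by (intro min_power_mono) (auto simp: add_divide_distrib[symmetric] divide_right_mono)
        also have "\<dots> \<le> 2 powr b * (min_power b (h1 x / l) + min_power b (h2 x / l))"
          using l nn pb by (intro min_power_add) auto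
        finally show ?case using nn l
          by (auto simp: ennreal_mult[symmetric] ennreal_plus[symmetric] min_power_nonneg simp del: ennreal_plus intro!: ennreal_leI)
      qed
    qed
    also have "\<dots> = ennreal (2 powr b) * ((\<integral>\<^sup>+x. ennreal (min_power b (h1 x / l)) \<partial>M) + (\<integral>\<^sup>+x. ennreal (min_power b (h2 x / l)) \<partial>M))"
      by (simp add: nn_integral_cmult nn_integral_add)
    also have "\<dots> \<le> ennreal (2 powr b) * (ennreal (2 * Q * l powr (- q)) * X l + ennreal (R * l powr (- b)) * Y l)"
    proof (intro mult_left_mono add_mono)
      have "(\<integral>\<^sup>+x. ennreal (min_power b (h1 x / l)) \<partial>M) \<le> ennreal (2 * l powr (- q)) * (ennreal Q * X l)"
        using q qb l w1 nn by (intro level_sets_imp_min_power M) auto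
      then show "(\<integral>\<^sup>+x. ennreal (min_power b (h1 x / l)) \<partial>M) \<le> ennreal (2 * Q * l powr (- q)) * X l"
        using Q by (simp add: ennreal_mult mult_ac)
      have "(\<integral>\<^sup>+x. ennreal (min_power b (h2 x / l)) \<partial>M) \<le> (\<integral>\<^sup>+x. ennreal (l powr (- b)) * ennreal (h2 x powr b) \<partial>M)"
        using nn l by (intro nn_integral_mono)
          (auto simp: min_power_def ennreal_mult[symmetric] powr_divide powr_minus field_simps intro!: ennreal_leI)
      also have "\<dots> = ennreal (l powr (- b)) * (\<integral>\<^sup>+x. ennreal (h2 x powr b) \<partial>M)"
        by (simp add: nn_integral_cmult)
      also have "\<dots> \<le> ennreal (l powr (- b)) * (ennreal R * Y l)"
        using w2 by (intro mult_left_mono) auto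
      finally show "(\<integral>\<^sup>+x. ennreal (min_power b (h2 x / l)) \<partial>M) \<le> ennreal (R * l powr (- b)) * Y l"
        using R by (simp add: ennreal_mult mult_ac)
    qed simp
    finally show ?thesis .
  qed
  define XX where "XX = (\<integral>\<^sup>+l. ennreal (if 0 < l then l powr (p - 1 - q) else 0) * X l \<partial>lborel)"
  define YY where "YY = (\<integral>\<^sup>+l. ennreal (if 0 < l then l powr (p - 1 - b) else 0) * Y l \<partial>lborel)"
  have XX: "XX = ennreal (1 / (p - q)) * U"
  proof -
    have "XX = (\<integral>\<^sup>+l. (\<integral>\<^sup>+x. ennreal (if 0 < l then l powr (p - 1 - q) else 0) *
        ennreal (if l \<le> u x then u x powr q else 0) \<partial>M) \<partial>lborel)"
      unfolding XX_def X_def by (simp add: nn_integral_cmult)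
    also have "\<dots> = (\<integral>\<^sup>+x. (\<integral>\<^sup>+l. ennreal (if 0 < l then l powr (p - 1 - q) else 0) *
        ennreal (if l \<le> u x then u x powr q else 0) \<partial>lborel) \<partial>M)"
      by (rule Fubini'[symmetric]) measurable
    also have "\<dots> = (\<integral>\<^sup>+x. ennreal (1 / (p - q)) * ennreal (u x powr p) \<partial>M)"
    proof (rule nn_integral_cong)
      fix x
      have "(\<integral>\<^sup>+l. ennreal (if 0 < l then l powr (p - 1 - q) else 0) *
          ennreal (if l \<le> u x then u x powr q else 0) \<partial>lborel)
        = (\<integral>\<^sup>+l. ennreal (u x powr q) * ennreal (if 0 \<le> l \<and> l \<le> u x then l powr (p - 1 - q) else 0) \<partial>lborel)"
        by (intro nn_integral_cong) (auto simp: mult.commute)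
      also have "\<dots> = ennreal (u x powr q) * ennreal (u x powr (p - q) / (p - q))"
        using nn_integral_powr_from_0[of "p - 1 - q" "u x"] qp u0 by (simp add: nn_integral_cmult)
      also have "\<dots> = ennreal (1 / (p - q)) * ennreal (u x powr p)"
        using qp by (simp add: ennreal_mult[symmetric] powr_add[symmetric])
      finally show "(\<integral>\<^sup>+l. ennreal (if 0 < l then l powr (p - 1 - q) else 0) *
          ennreal (if l \<le> u x then u x powr q else 0) \<partial>lborel) = ennreal (1 / (p - q)) * ennreal (u x powr p)" .
    qed
    also have "\<dots> = ennreal (1 / (p - q)) * U" unfolding U_def by (simp add: nn_integral_cmult)
    finally show ?thesis .
  qed
  have YY: "YY = ennreal (1 / (b - p)) * U"
  proof -
    have "YY = (\<integral>\<^sup>+l. (\<integral>\<^sup>+x. ennreal (if 0 < l then l powr (p - 1 - b) else 0) *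
        ennreal (if u x < l then u x powr b else 0) \<partial>M) \<partial>lborel)"
      unfolding YY_def Y_def by (simp add: nn_integral_cmult)
    also have "\<dots> = (\<integral>\<^sup>+x. (\<integral>\<^sup>+l. ennreal (if 0 < l then l powr (p - 1 - b) else 0) *
        ennreal (if u x < l then u x powr b else 0) \<partial>lborel) \<partial>M)"
      by (rule Fubini'[symmetric]) measurable
    also have "\<dots> = (\<integral>\<^sup>+x. ennreal (1 / (b - p)) * ennreal (u x powr p) \<partial>M)"
    proof (rule nn_integral_cong)
      fix x
      have "(\<integral>\<^sup>+l. ennreal (if 0 < l then l powr (p - 1 - b) else 0) *
          ennreal (if u x < l then u x powr b else 0) \<partial>lborel)
        = (\<integral>\<^sup>+l. ennreal (u x powr b) * ennreal (if u x < l then l powr (p - 1 - b) else 0) \<partial>lborel)"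
        using u0[of x] by (intro nn_integral_cong) (auto simp: mult.commute)
      also have "\<dots> = ennreal (1 / (b - p)) * ennreal (u x powr p)"
      proof (cases "u x = 0")
        case False
        then have "0 < u x" using u0[of x] by simp
        then have "(\<integral>\<^sup>+l. ennreal (if u x < l then l powr (p - 1 - b) else 0) \<partial>lborel)
            = ennreal (u x powr (p - b) / (b - p))"
          using nn_integral_powr_to_inf[of "p - 1 - b" "u x"] pb by simp
        then have "(\<integral>\<^sup>+l. ennreal (u x powr b) * ennreal (if u x < l then l powr (p - 1 - b) else 0) \<partial>lborel)
            = ennreal (u x powr b) * ennreal (u x powr (p - b) / (b - p))"
          by (simp add: nn_integral_cmult)
        then show ?thesis
          using pb by (simp add: ennreal_mult[symmetric] powr_add[symmetric])
      qed simp
      finally show "(\<integral>\<^sup>+l. ennreal (if 0 < l then l powr (p - 1 - b) else 0) *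
          ennreal (if u x < l then u x powr b else 0) \<partial>lborel) = ennreal (1 / (b - p)) * ennreal (u x powr p)" .
    qed
    also have "\<dots> = ennreal (1 / (b - p)) * U" unfolding U_def by (simp add: nn_integral_cmult)
    finally show ?thesis .
  qed
  have "ennreal c * (\<integral>\<^sup>+x. ennreal (h x powr p) \<partial>M)
      = (\<integral>\<^sup>+x. (\<integral>\<^sup>+l. ennreal (if 0 < l then l powr (p - 1) * min_power b (h x / l) else 0) \<partial>lborel) \<partial>M)"
    using min_power_scale_integral[OF pb h0] c
    by (simp add: nn_integral_cmult[symmetric] c_def[symmetric] ennreal_mult)
  also have "\<dots> = (\<integral>\<^sup>+l. (\<integral>\<^sup>+x. ennreal (if 0 < l then l powr (p - 1) * min_power b (h x / l) else 0) \<partial>M) \<partial>lborel)"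
    by (rule Fubini') (unfold min_power_def, measurable)
  also have "\<dots> \<le> (\<integral>\<^sup>+l. ennreal (2 powr b) *
      (ennreal (2 * Q) * (ennreal (if 0 < l then l powr (p - 1 - q) else 0) * X l)
        + ennreal R * (ennreal (if 0 < l then l powr (p - 1 - b) else 0) * Y l)) \<partial>lborel)"
  proof (rule nn_integral_mono)
    fix l :: real
    show "(\<integral>\<^sup>+x. ennreal (if 0 < l then l powr (p - 1) * min_power b (h x / l) else 0) \<partial>M)
      \<le> ennreal (2 powr b) *
      (ennreal (2 * Q) * (ennreal (if 0 < l then l powr (p - 1 - q) else 0) * X l)
        + ennreal R * (ennreal (if 0 < l then l powr (p - 1 - b) else 0) * Y l))"
    proof (cases "0 < l")
      case True
      have "(\<integral>\<^sup>+x. ennreal (if 0 < l then l powr (p - 1) * min_power b (h x / l) else 0) \<partial>M)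
          = (\<integral>\<^sup>+x. ennreal (l powr (p - 1)) * ennreal (min_power b (h x / l)) \<partial>M)"
        using True h0 by (simp add: ennreal_mult min_power_nonneg)
      also have "\<dots> = ennreal (l powr (p - 1)) * (\<integral>\<^sup>+x. ennreal (min_power b (h x / l)) \<partial>M)"
        by (rule nn_integral_cmult) (unfold min_power_def, measurable)
      also have "\<dots> \<le> ennreal (l powr (p - 1)) * (ennreal (2 powr b) * (ennreal (2 * Q * l powr (- q)) * X l + ennreal (R * l powr (- b)) * Y l))"
        using one[OF True] by (intro mult_left_mono) auto
      also have "\<dots> = ennreal (2 powr b) * (ennreal (2 * Q * (l powr (p - 1) * l powr (- q))) * X l + ennreal (R * (l powr (p - 1) * l powr (- b))) * Y l)"
        using Q R by (simp add: ennreal_mult algebra_simps)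
      also have "l powr (p - 1) * l powr (- q) = l powr (p - 1 - q)"
        using powr_add[of l "p - 1" "- q"] by simp
      also have "l powr (p - 1) * l powr (- b) = l powr (p - 1 - b)"
        using powr_add[of l "p - 1" "- b"] by simp
      finally show ?thesis using True Q R by (simp add: ennreal_mult mult.assoc)
    qed simp
  qed
  also have "\<dots> = ennreal (2 powr b) * (ennreal (2 * Q) * XX + ennreal R * YY)"
    unfolding XX_def YY_def by (simp add: nn_integral_cmult nn_integral_add)
  also have "\<dots> = ennreal (2 powr b * (2 * Q * (1 / (p - q)) + R * (1 / (b - p)))) * U"
    unfolding XX YY using Q R qp pb by (intro ennreal_lincomb_common_factor) auto
  also have "\<dots> \<le> ennreal (c * (2 powr b * (4 * Q + R))) * U"
  proof (intro mult_right_mono ennreal_leI)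
    have "1 / (p - q) \<le> 2 / (p - 1)" using q qp pb by (simp add: field_simps)
    then have "2 * Q * (1 / (p - q)) \<le> 2 * Q * (2 / (p - 1))" using Q by (intro mult_left_mono) auto
    also have "\<dots> = 4 * Q * (1 / (p - 1))" by simp
    finally have "2 * Q * (1 / (p - q)) + R * (1 / (b - p)) \<le> 4 * Q * (1 / (p - 1)) + R * (1 / (b - p))" by simp
    also have "\<dots> \<le> 4 * Q * c + R * c"
      using Q R pb unfolding c_def by (intro add_mono mult_left_mono) auto
    finally have "2 powr b * (2 * Q * (1 / (p - q)) + R * (1 / (b - p))) \<le> 2 powr b * (4 * Q * c + R * c)"
      by (intro mult_left_mono) auto
    then show "2 powr b * (2 * Q * (1 / (p - q)) + R * (1 / (b - p))) \<le> c * (2 powr b * (4 * Q + R))"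
      by (simp add: algebra_simps)
  qed simp
  also have "\<dots> = ennreal c * (ennreal (2 powr b * (4 * Q + R)) * U)"
    using c Q R by (simp add: ennreal_mult mult.assoc)
  finally show ?thesis unfolding U_def using c
    by (simp add: ennreal_mult_le_mult_iff)
qed

section \<open>Extrapolation to $L^p$\<close>

lemma Lp_norm_le_iff:
  assumes p: "0 < p" and K: "0 \<le> K"
  shows "Lp_norm p M h \<le> K * Lp_norm p M f \<longleftrightarrow>
    (\<integral>x. norm (h x) powr p \<partial>M) \<le> K powr p * (\<integral>x. norm (f x) powr p \<partial>M)"
proof -
  define a where "a = (\<integral>x. norm (h x) powr p \<partial>M)"
  define b where "b = (\<integral>x. norm (f x) powr p \<partial>M)"
  have ab: "0 \<le> a" "0 \<le> b" unfolding a_def b_def by auto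
  have "a powr (1 / p) \<le> K * b powr (1 / p) \<longleftrightarrow> a \<le> K powr p * b"
  proof
    assume "a powr (1 / p) \<le> K * b powr (1 / p)"
    then have "(a powr (1 / p)) powr p \<le> (K * b powr (1 / p)) powr p"
      using p by (intro powr_mono2) auto
    then show "a \<le> K powr p * b" using p K ab by (simp add: powr_powr powr_mult)
  next
    assume "a \<le> K powr p * b"
    then have "a powr (1 / p) \<le> (K powr p * b) powr (1 / p)"
      using p ab by (intro powr_mono2) auto
    then show "a powr (1 / p) \<le> K * b powr (1 / p)" using p K ab by (simp add: powr_powr powr_mult)
  qed
  then show ?thesis unfolding Lp_norm_def a_def b_def .
qed

lemma nn_integral_Lp:
  assumes "f \<in> Lp_space p M"
  shows "(\<integral>\<^sup>+x. ennreal (norm (f x) powr p) \<partial>M) = ennreal (\<integral>x. norm (f x) powr p \<partial>M)"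
  using assms unfolding Lp_space_def by (intro nn_integral_eq_integral) auto

lemma Lp_space_mono:
  assumes M: "finite_measure M" and q: "0 < q" "q \<le> p" and f: "f \<in> Lp_space p M"
  shows "f \<in> Lp_space q M"
proof -
  interpret finite_measure M by (rule M)
  have [measurable]: "f \<in> borel_measurable M" using f unfolding Lp_space_def by blast
  have "norm (f x) powr q \<le> 1 + norm (f x) powr p" for x
  proof (cases "1 \<le> norm (f x)")
    case True
    then show ?thesis using powr_mono[of q p "norm (f x)"] q by simp
  next
    case False
    then have "norm (f x) powr q \<le> 1 powr q" using q by (intro powr_mono2) auto
    then show ?thesis by (simp add: add_increasing2)
  qed
  moreover have "integrable M (\<lambda>x. 1 + norm (f x) powr p)" using f unfolding Lp_space_def by auto
  ultimately have "integrable M (\<lambda>x. norm (f x) powr q)"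
    by (rule_tac Bochner_Integration.integrable_bound) (auto simp: add_nonneg_nonneg)
  then show ?thesis unfolding Lp_space_def by auto
qed

lemma Lp_space_dominated:
  assumes g: "g \<in> Lp_space p M" and f[measurable]: "f \<in> borel_measurable M"
    and p: "0 \<le> p" and le: "\<And>x. norm (f x) \<le> norm (g x)"
  shows "f \<in> Lp_space p M"
proof -
  have "integrable M (\<lambda>x. norm (g x) powr p)" using g unfolding Lp_space_def by auto
  then have "integrable M (\<lambda>x. norm (f x) powr p)"
    by (rule Bochner_Integration.integrable_bound) (use le p in \<open>auto intro!: powr_mono2\<close>)
  then show ?thesis unfolding Lp_space_def by auto
qed

context compact_homogeneous_space
begin

text \<open>The exponent \<open>q = 1 + (p - 1) / (2 * p0)\<close> stays below 2 and keeps \<open>p - q\<close> comparable to \<open>p - 1\<close>,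
\<open>p0 - q\<close> comparable to \<open>p0 - 1\<close>, and \<open>q - 1\<close> comparable to \<open>p - 1\<close>.\<close>

lemma extrapolation:
  fixes T :: "('a \<Rightarrow> complex) \<Rightarrow> ('a \<Rightarrow> complex)"
  assumes r: "0 < r" and p: "1 < p" "p < p0"
    and lin: "linear_operator_on (LlogL_space r M) M T"
    and inv: "translation_invariant_on (LlogL_space r M) M G T"
    and T1: "\<And>f. f \<in> LlogL_space r M \<Longrightarrow> T f \<in> Lp_space 1 M"
    and K1: "0 \<le> K1" "\<And>f. f \<in> LlogL_space r M \<Longrightarrow> Lp_norm 1 M (T f) \<le> K1 * LlogL_norm r M f"
    and T0: "\<And>f. f \<in> Lp_space p0 M \<Longrightarrow> T f \<in> Lp_space p0 M"
    and K0: "0 \<le> K0" "\<And>f. f \<in> Lp_space p0 M \<Longrightarrow> Lp_norm p0 M (T f) \<le> K0 * Lp_norm p0 M f"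
    and f: "f \<in> Lp_space p M"
  defines "\<mu> \<equiv> measure M UNIV"
  defines "C \<equiv> 5 * 2 powr p0 * (1 + K0) powr p0 *
    (16 * (1 + K1) * (1 + 16 * r powr r * (\<mu> + 1)) * (1 + 1 / \<mu>)) * (2 * p0) powr r"
  shows "T f \<in> Lp_space p M" "Lp_norm p M (T f) \<le> C * (p - 1) powr (- r) * Lp_norm p M f"
proof -
  have fin: "finite_measure M" and sig: "sigma_finite_measure M" by unfold_locales
  have \<mu>: "0 < \<mu>" unfolding \<mu>_def by (rule measure_pos)
  define q where "q = 1 + (p - 1) / (2 * p0)"
  have q: "1 < q" "q \<le> 2" "q < p" "p - 1 \<le> 2 * (p - q)" "p0 - 1 \<le> 2 * (p0 - q)"
  proof -
    have "0 < (p - 1) / (2 * p0)" using p by simp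
    then show "1 < q" unfolding q_def by simp
    have "(p - 1) / (2 * p0) \<le> 1" using p by (subst divide_le_eq_1_pos) auto
    then show "q \<le> 2" unfolding q_def by simp
    have "(p - 1) / (2 * p0) \<le> (p - 1) / 2" using p by (intro divide_left_mono) auto
    then have *: "q - 1 \<le> (p - 1) / 2" unfolding q_def by simp
    then show "q < p" "p - 1 \<le> 2 * (p - q)" "p0 - 1 \<le> 2 * (p0 - q)" using p by (auto simp: field_simps)
  qed
  have sub: "Lp_space q M \<subseteq> LlogL_space r M"
    using Lp_space_subset_LlogL(1)[OF fin r q(1,2)] by blast
  have lin': "linear_operator_on (Lp_space q M) M T"
    using lin sub unfolding linear_operator_on_def by (meson subsetD)
  have inv': "translation_invariant_on (Lp_space q M) M G T"
    using inv sub unfolding translation_invariant_on_def by (meson subsetD)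
  have T1': "\<And>F. F \<in> Lp_space q M \<Longrightarrow> T F \<in> Lp_space 1 M" using T1 sub by blast
  define D where "D = 1 + 16 * r powr r * (\<mu> + 1)"
  define Y where "Y = (q - 1) powr (- r)"
  \<comment> \<open>\<open>1 + K1\<close> instead of \<open>K1\<close>, since \<open>level_set_estimate\<close> needs \<open>\<kappa>\<close> positive\<close>
  define \<kappa> where "\<kappa> = (1 + K1) * (D * Y)"
  have D: "1 \<le> D" unfolding D_def using \<mu> by simp
  have Y: "1 \<le> Y" using powr_mono'[of "- r" 0 "q - 1"] q r unfolding Y_def by simp
  have \<kappa>: "0 < \<kappa>" unfolding \<kappa>_def using K1(1) D Y by (intro mult_pos_pos) auto
  have bound: "(\<integral>x. norm (T F x) \<partial>M) \<le> \<kappa> * (s + s powr (1 - q) * (\<integral>x. norm (F x) powr q \<partial>M))"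
    if F: "F \<in> Lp_space q M" and s: "0 < s" for F s
  proof -
    have "(\<integral>x. norm (T F x) \<partial>M) = Lp_norm 1 M (T F)" unfolding Lp_norm_def by simp
    also have "\<dots> \<le> K1 * LlogL_norm r M F" using K1(2) F sub by blast
    also have "\<dots> \<le> (1 + K1) * LlogL_norm r M F"
      using LlogL_norm_nonneg[of F r M] F sub r by (intro mult_right_mono) auto
    also have "\<dots> \<le> (1 + K1) * (D * Y * (s + s powr (1 - q) * (\<integral>x. norm (F x) powr q \<partial>M)))"
      using Lp_space_subset_LlogL(2)[OF fin r q(1,2) F s] K1(1)
      by (intro mult_left_mono) (auto simp: D_def Y_def \<mu>_def space_M)
    finally show ?thesis unfolding \<kappa>_def by (simp only: mult.assoc)
  qed
  define Q where "Q = 8 * \<kappa> * (16 * \<kappa> / \<mu>) powr (q - 1)"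
  have Q: "0 \<le> Q" unfolding Q_def using \<kappa> by simp
  have fm[measurable]: "f \<in> borel_measurable M" using f unfolding Lp_space_def by blast
  have fq: "f \<in> Lp_space q M" using q by (intro Lp_space_mono[OF fin _ _ f]) auto
  have Tfm[measurable]: "T f \<in> borel_measurable M" using T1'[OF fq] unfolding Lp_space_def by blast
  have main: "(\<integral>\<^sup>+x. ennreal (norm (T f x) powr p) \<partial>M)
    \<le> ennreal (2 powr p0 * (4 * Q + K0 powr p0)) * (\<integral>\<^sup>+x. ennreal (norm (f x) powr p) \<partial>M)"
  proof (rule interpolation[OF sig _ _ _ _ p q(1,4,5) Q])
    fix l :: real assume l: "0 < l"
    \<comment> \<open>\<open>f1\<close> is controlled by the level set estimate, the bounded part \<open>f2\<close> by \<open>K0\<close>\<close>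
    define f1 where "f1 x = (if l \<le> norm (f x) then f x else 0)" for x
    define f2 where "f2 x = (if l \<le> norm (f x) then 0 else f x)" for x
    have [measurable]: "f1 \<in> borel_measurable M" "f2 \<in> borel_measurable M"
      unfolding f1_def f2_def by measurable
    have f1: "f1 \<in> Lp_space q M" and f2: "f2 \<in> Lp_space q M"
      using q by (auto intro!: Lp_space_dominated[OF fq] simp: f1_def f2_def)
    have f20: "f2 \<in> Lp_space p0 M"
    proof (rule Lp_space_dominated)
      show "(\<lambda>x. complex_of_real l) \<in> Lp_space p0 M" unfolding Lp_space_def by simp
    qed (use p l in \<open>auto simp: f2_def\<close>)
    have "(\<lambda>y. 1 * f1 y + 1 * f2 y) = f" by (auto simp: f1_def f2_def)
    then have "AE x in M. T f x = 1 * T f1 x + 1 * T f2 x"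
      using lin' f1 f2 unfolding linear_operator_on_def by metis
    then have le: "AE x in M. norm (T f x) \<le> norm (T f1 x) + norm (T f2 x)"
      by eventually_elim (simp add: norm_triangle_ineq)
    have Tm: "T f1 \<in> borel_measurable M" "T f2 \<in> borel_measurable M"
      using T1'[OF f1] T1'[OF f2] unfolding Lp_space_def by auto
    have X: "(\<integral>\<^sup>+x. ennreal (if l \<le> norm (f x) then norm (f x) powr q else 0) \<partial>M)
      = ennreal (\<integral>x. norm (f1 x) powr q \<partial>M)"
      unfolding nn_integral_Lp[OF f1, symmetric] by (intro nn_integral_cong) (auto simp: f1_def)
    have w1: "(\<integral>\<^sup>+x. ennreal (if s \<le> norm (T f1 x) then norm (T f1 x) else 0) \<partial>M)
      \<le> ennreal (s powr (1 - q)) * (ennreal Q * (\<integral>\<^sup>+x. ennreal (if l \<le> norm (f x) then norm (f x) powr q else 0) \<partial>M))"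
      if s: "0 < s" for s
    proof -
      define E where "E = {x. s \<le> norm (T f1 x)}"
      have "{x \<in> space M. s \<le> norm (T f1 x)} \<in> sets M" using Tm(1) by measurable
      then have E: "E \<in> sets M" by (simp add: E_def space_M)
      have int: "integrable M (\<lambda>x. norm (T f1 x) * indicator E x)"
        using integrable_mult_indicator[OF E image_norm_integrable[OF _ _ lin' T1' f1]] q
        by (simp add: mult.commute)
      have "(\<integral>\<^sup>+x. ennreal (if s \<le> norm (T f1 x) then norm (T f1 x) else 0) \<partial>M)
          = (\<integral>\<^sup>+x. ennreal (norm (T f1 x) * indicator E x) \<partial>M)"
        by (intro nn_integral_cong) (auto simp: E_def)
      also have "\<dots> = ennreal (\<integral>x. norm (T f1 x) * indicator E x \<partial>M)"
        using int by (intro nn_integral_eq_integral) auto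
      also have "\<dots> \<le> ennreal (s powr (1 - q) * (Q * (\<integral>x. norm (f1 x) powr q \<partial>M)))"
      proof (rule ennreal_leI)
        have "(16 * \<kappa> / (\<mu> * s)) powr (q - 1) = (16 * \<kappa> / \<mu>) powr (q - 1) * s powr (1 - q)"
        proof -
          have "(16 * \<kappa> / (\<mu> * s)) powr (q - 1) = ((16 * \<kappa> / \<mu>) / s) powr (q - 1)" by simp
          also have "\<dots> = (16 * \<kappa> / \<mu>) powr (q - 1) / s powr (q - 1)"
            by (rule powr_divide)
          also have "\<dots> = (16 * \<kappa> / \<mu>) powr (q - 1) * s powr (- (q - 1))"
            by (simp only: powr_minus divide_inverse)
          finally show ?thesis by simp
        qed
        then show "(\<integral>x. norm (T f1 x) * indicator E x \<partial>M) \<le> s powr (1 - q) * (Q * (\<integral>x. norm (f1 x) powr q \<partial>M))"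
          using level_set_estimate[OF _ q(2) lin' inv' T1' \<kappa> bound f1 s] q(1)
          unfolding Q_def E_def \<mu>_def[symmetric] by (simp add: mult_ac)
      qed
      finally show ?thesis unfolding X using Q by (simp add: ennreal_mult)
    qed
    have w2: "(\<integral>\<^sup>+x. ennreal (norm (T f2 x) powr p0) \<partial>M)
      \<le> ennreal (K0 powr p0) * (\<integral>\<^sup>+x. ennreal (if norm (f x) < l then norm (f x) powr p0 else 0) \<partial>M)"
    proof -
      have "(\<integral>x. norm (T f2 x) powr p0 \<partial>M) \<le> K0 powr p0 * (\<integral>x. norm (f2 x) powr p0 \<partial>M)"
        using Lp_norm_le_iff[of p0 K0 M "T f2" f2] K0(1) K0(2)[OF f20] p by simp
      moreover have "(\<integral>\<^sup>+x. ennreal (if norm (f x) < l then norm (f x) powr p0 else 0) \<partial>M)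
        = ennreal (\<integral>x. norm (f2 x) powr p0 \<partial>M)"
        unfolding nn_integral_Lp[OF f20, symmetric] by (intro nn_integral_cong) (auto simp: f2_def)
      ultimately show ?thesis
        by (simp add: nn_integral_Lp[OF T0[OF f20]] ennreal_mult[symmetric] ennreal_leI)
    qed
    show "\<exists>h1 h2. h1 \<in> borel_measurable M \<and> h2 \<in> borel_measurable M \<and>
      (\<forall>x. 0 \<le> h1 x) \<and> (\<forall>x. 0 \<le> h2 x) \<and> (AE x in M. norm (T f x) \<le> h1 x + h2 x) \<and>
      (\<forall>s>0. (\<integral>\<^sup>+x. ennreal (if s \<le> h1 x then h1 x else 0) \<partial>M)
        \<le> ennreal (s powr (1 - q)) * (ennreal Q * (\<integral>\<^sup>+x. ennreal (if l \<le> norm (f x) then norm (f x) powr q else 0) \<partial>M))) \<and>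
      (\<integral>\<^sup>+x. ennreal (h2 x powr p0) \<partial>M) \<le> ennreal (K0 powr p0) * (\<integral>\<^sup>+x. ennreal (if norm (f x) < l then norm (f x) powr p0 else 0) \<partial>M)"
    proof (rule exI[of _ "\<lambda>x. norm (T f1 x)"], rule exI[of _ "\<lambda>x. norm (T f2 x)"], intro conjI allI impI)
    qed (use Tm le w1 w2 in simp_all)
  qed simp_all
  define B where "B = 2 powr p0 * (4 * Q + K0 powr p0)"
  have B: "0 \<le> B" unfolding B_def using Q by simp
  have nn: "(\<integral>\<^sup>+x. ennreal (norm (T f x) powr p) \<partial>M) \<le> ennreal (B * (\<integral>x. norm (f x) powr p \<partial>M))"
    using main B unfolding nn_integral_Lp[OF f] B_def[symmetric] by (simp add: ennreal_mult)
  have "integrable M (\<lambda>x. norm (T f x) powr p)"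
    using nn by (intro integrableI_bounded) (auto simp: less_top[symmetric] top_unique)
  then show Tf: "T f \<in> Lp_space p M" unfolding Lp_space_def using Tfm by simp
  have int: "(\<integral>x. norm (T f x) powr p \<partial>M) \<le> B * (\<integral>x. norm (f x) powr p \<partial>M)"
    using nn B unfolding nn_integral_Lp[OF Tf] by (simp add: ennreal_le_iff)
  define J where "J = (1 + K1) * D"
  define H where "H = 16 * J * (1 + 1 / \<mu>)"
  define W where "W = 5 * 2 powr p0 * (1 + K0) powr p0"
  have J: "1 \<le> J" unfolding J_def using K1(1) D mult_mono[of 1 "1 + K1" 1 D] by simp
  have \<kappa>J: "\<kappa> = J * Y" unfolding \<kappa>_def J_def by simp
  have "H = 16 * J + 16 * J / \<mu>" unfolding H_def by (simp add: distrib_left)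
  moreover have "0 \<le> 16 * J / \<mu>" using J \<mu> by simp
  ultimately have H1: "16 * J \<le> H" and H2: "16 * J / \<mu> \<le> H" using J by linarith+
  have H: "1 \<le> H" using H1 J by linarith
  have HY: "1 \<le> H * Y" using mult_mono[of 1 H 1 Y] H Y by simp
  have "16 * \<kappa> \<le> H * Y" using mult_right_mono[OF H1, of Y] Y unfolding \<kappa>J by simp
  then have e1: "8 * \<kappa> \<le> H * Y" using \<kappa> by simp
  have e2: "16 * \<kappa> / \<mu> \<le> H * Y" using mult_right_mono[OF H2, of Y] Y unfolding \<kappa>J by simp
  have "Q \<le> H * Y * (H * Y) powr (q - 1)"
    unfolding Q_def
  proof (rule mult_mono[OF e1])
    show "(16 * \<kappa> / \<mu>) powr (q - 1) \<le> (H * Y) powr (q - 1)"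
      using e2 \<kappa> \<mu> q by (intro powr_mono2) auto
  qed (use HY in auto)
  also have "\<dots> = (H * Y) powr q" using HY powr_mult_base[of "H * Y" "q - 1"] by simp
  also have "\<dots> \<le> (H * Y) powr p" using HY q by (intro powr_mono) auto
  finally have QHY: "Q \<le> (H * Y) powr p" .
  \<comment> \<open>Since \<open>W\<close>, \<open>H * Y\<close> and \<open>1 + K0\<close> are at least 1, raising them to higher powers is harmless; this
    brings the bound into the form of a \<open>p\<close>-th power.\<close>
  have P1: "1 \<le> (H * Y) powr p" using HY p by (intro ge_one_powr_ge_zero) auto
  have P2: "1 \<le> (1 + K0) powr p0" using K0(1) p by (intro ge_one_powr_ge_zero) auto
  have "1 * Q \<le> (1 + K0) powr p0 * (H * Y) powr p"
    by (rule mult_mono[OF P2 QHY]) (use Q in auto)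
  then have "Q \<le> (1 + K0) powr p0 * (H * Y) powr p" by simp
  moreover have "K0 powr p0 \<le> (1 + K0) powr p0 * (H * Y) powr p"
  proof -
    have "K0 powr p0 \<le> (1 + K0) powr p0" using K0(1) p by (intro powr_mono2) auto
    from mult_mono[OF this P1] show ?thesis by simp
  qed
  ultimately have "4 * Q + K0 powr p0 \<le> 5 * ((1 + K0) powr p0 * (H * Y) powr p)" by simp
  then have "B \<le> 2 powr p0 * (5 * ((1 + K0) powr p0 * (H * Y) powr p))"
    unfolding B_def by (intro mult_left_mono) auto
  also have "\<dots> = W * (H * Y) powr p" unfolding W_def by (simp only: mult_ac)
  also have "\<dots> \<le> W powr p * (H * Y) powr p"
  proof (intro mult_right_mono)
    have "1 \<le> 2 powr p0" using p by (intro ge_one_powr_ge_zero) auto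
    then have "1 * 1 \<le> (5 * 2 powr p0) * (1 + K0) powr p0"
      using P2 by (intro mult_mono) auto
    then have "1 \<le> W" unfolding W_def by simp
    then show "W \<le> W powr p" using powr_mono[of 1 p W] p by simp
  qed simp
  also have "\<dots> = (W * (H * Y)) powr p" by (simp add: powr_mult)
  finally have BW: "B \<le> (W * (H * Y)) powr p" .
  have "(\<integral>x. norm (T f x) powr p \<partial>M) \<le> (W * (H * Y)) powr p * (\<integral>x. norm (f x) powr p \<partial>M)"
    by (rule order_trans[OF int mult_right_mono[OF BW]]) simp
  moreover have "0 \<le> W * (H * Y)"
    by (rule mult_nonneg_nonneg) (use HY in \<open>auto simp: W_def\<close>)
  ultimately have "Lp_norm p M (T f) \<le> W * (H * Y) * Lp_norm p M f"
    using Lp_norm_le_iff[of p "W * (H * Y)" M "T f" f] p by simp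
  moreover have "W * (H * Y) = C * (p - 1) powr (- r)"
  proof -
    have "Y = (2 * p0) powr r * (p - 1) powr (- r)"
      using powr_divide[of "p - 1" "2 * p0" "- r"] unfolding Y_def q_def by (simp add: powr_minus_divide)
    then show ?thesis unfolding C_def W_def H_def J_def D_def by (simp only: mult_ac)
  qed
  ultimately show "Lp_norm p M (T f) \<le> C * (p - 1) powr (- r) * Lp_norm p M f" by simp
qed

end

lemma symmetric_space_homogeneous:
  assumes X: "compact_symmetric_space \<A> g" and G: "compact_symmetry_group \<A> g G"
    and M: "finite_invariant_measure G M"
  shows "compact_homogeneous_space M G"
proof -
  have sub: "subgroup G (BijGroup UNIV)" and iso: "\<And>\<Omega>. \<Omega> \<in> G \<Longrightarrow> riemannian_isometry \<A> g \<Omega>"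
    using G unfolding compact_symmetry_group_def by auto
  interpret finite_measure M using M unfolding finite_invariant_measure_def by blast
  show ?thesis
  proof (unfold_locales)
    show "compact (UNIV :: 'a set)" using X unfolding compact_symmetric_space_def by blast
    show "sets M = sets borel" using M unfolding finite_invariant_measure_def by blast
    show "0 < measure M UNIV"
      using M unfolding finite_invariant_measure_def by (simp add: emeasure_eq_measure)
    have "(\<lambda>x\<in>UNIV. x) \<in> G" using subgroup.one_closed[OF sub] by (simp add: BijGroup_def)
    then show "id \<in> G" by (simp add: restrict_def id_def)
    show "\<Omega> \<circ> \<Theta> \<in> G" if "\<Omega> \<in> G" "\<Theta> \<in> G" for \<Omega> \<Theta>
    proof -
      have "\<Omega> \<in> Bij UNIV" "\<Theta> \<in> Bij UNIV"
        using subgroup.subset[OF sub] that by (auto simp: BijGroup_def)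
      then have "\<Omega> \<otimes>\<^bsub>BijGroup UNIV\<^esub> \<Theta> = \<Omega> \<circ> \<Theta>"
        by (simp add: BijGroup_def compose_def restrict_def o_def)
      then show ?thesis using subgroup.m_closed[OF sub that] by simp
    qed
    show "continuous_on UNIV \<Omega>" if "\<Omega> \<in> G" for \<Omega>
      using iso[OF that] unfolding riemannian_isometry_def smooth_map_def by blast
    show "compactin compact_open_topology G" "\<exists>\<Omega>\<in>G. \<Omega> x = y" for x y
      using G unfolding compact_symmetry_group_def by auto
    show "distr M M \<Omega> = M" if "\<Omega> \<in> G" for \<Omega>
      using M that unfolding finite_invariant_measure_def by blast
  qed
qed

theorem theorem1p1:
  fixes \<A> :: "('a::{t2_space,second_countable_topology}, 'e::real_normed_vector) chart set"
    and g :: "('a, 'e) metric_tensor"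
    and G :: "('a \<Rightarrow> 'a) set"
    and M :: "'a measure"
    and r p\<^sub>0 :: real
  assumes "compact_symmetric_space \<A> g"
    and "compact_symmetry_group \<A> g G"
    and "finite_invariant_measure G M"
    and "0 < r"
    and "1 < p\<^sub>0"
  shows "\<exists>C :: real \<Rightarrow> real \<Rightarrow> real. \<forall>T :: ('a \<Rightarrow> complex) \<Rightarrow> ('a \<Rightarrow> complex).
    linear_operator_on (LlogL_space r M) M T \<and>
    translation_invariant_on (LlogL_space r M) M G T \<and>
    bounded_operator (LlogL_space r M) (LlogL_norm r M) (Lp_space 1 M) (Lp_norm 1 M) T \<and>
    bounded_operator (Lp_space p\<^sub>0 M) (Lp_norm p\<^sub>0 M) (Lp_space p\<^sub>0 M) (Lp_norm p\<^sub>0 M) T \<longrightarrow>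
    (\<forall>p f. 1 < p \<and> p < p\<^sub>0 \<and> f \<in> Lp_space p M \<longrightarrow>
       T f \<in> Lp_space p M \<and>
       Lp_norm p M (T f) \<le>
         C (operator_norm (LlogL_space r M) (LlogL_norm r M) (Lp_norm 1 M) T)
           (operator_norm (Lp_space p\<^sub>0 M) (Lp_norm p\<^sub>0 M) (Lp_norm p\<^sub>0 M) T)
         * (p - 1) powr (- r) * Lp_norm p M f)"
proof -
  interpret compact_homogeneous_space M G
    by (rule symmetric_space_homogeneous[OF assms(1-3)])
  define C where "C K1 K0 = 5 * 2 powr p\<^sub>0 * (1 + K0) powr p\<^sub>0 *
    (16 * (1 + K1) * (1 + 16 * r powr r * (measure M UNIV + 1)) * (1 + 1 / measure M UNIV)) *
    (2 * p\<^sub>0) powr r" for K1 K0 :: real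
  have nonneg: "0 \<le> LlogL_norm r M f" if "f \<in> LlogL_space r M" for f
    by (rule LlogL_norm_nonneg[OF that assms(4)])
  have nonneg': "0 \<le> Lp_norm p\<^sub>0 M f" for f unfolding Lp_norm_def by simp
  show ?thesis
  proof (rule exI[of _ C], intro allI impI)
    fix T :: "('a \<Rightarrow> complex) \<Rightarrow> ('a \<Rightarrow> complex)" and p :: real and f :: "'a \<Rightarrow> complex"
    assume T: "linear_operator_on (LlogL_space r M) M T \<and>
      translation_invariant_on (LlogL_space r M) M G T \<and>
      bounded_operator (LlogL_space r M) (LlogL_norm r M) (Lp_space 1 M) (Lp_norm 1 M) T \<and>
      bounded_operator (Lp_space p\<^sub>0 M) (Lp_norm p\<^sub>0 M) (Lp_space p\<^sub>0 M) (Lp_norm p\<^sub>0 M) T"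
      and p: "1 < p \<and> p < p\<^sub>0 \<and> f \<in> Lp_space p M"
    let ?K1 = "operator_norm (LlogL_space r M) (LlogL_norm r M) (Lp_norm 1 M) T"
    let ?K0 = "operator_norm (Lp_space p\<^sub>0 M) (Lp_norm p\<^sub>0 M) (Lp_norm p\<^sub>0 M) T"
    have b1: "bounded_operator (LlogL_space r M) (LlogL_norm r M) (Lp_space 1 M) (Lp_norm 1 M) T"
      and b0: "bounded_operator (Lp_space p\<^sub>0 M) (Lp_norm p\<^sub>0 M) (Lp_space p\<^sub>0 M) (Lp_norm p\<^sub>0 M) T"
      using T by auto
    have maps: "\<And>f. f \<in> LlogL_space r M \<Longrightarrow> T f \<in> Lp_space 1 M"
      "\<And>f. f \<in> Lp_space p\<^sub>0 M \<Longrightarrow> T f \<in> Lp_space p\<^sub>0 M"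
      using b1 b0 unfolding bounded_operator_def by auto
    note ext = extrapolation[OF assms(4) _ _ _ _ maps(1)
        operator_norm_bound(1)[OF b1 nonneg] operator_norm_bound(2)[OF b1 nonneg] maps(2)
        operator_norm_bound(1)[OF b0 nonneg'] operator_norm_bound(2)[OF b0 nonneg'],
        folded C_def]
    show "T f \<in> Lp_space p M \<and> Lp_norm p M (T f) \<le> C ?K1 ?K0 * (p - 1) powr (- r) * Lp_norm p M f"
      using ext[of p f] T p by auto
  qed
qed

end
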